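(* Let $(D,\epsilon)\in\mathcal R$. For a threshold $S$, let $\pi^S$ be the online safe policy, which uses both servers ($u_t=1$) for $t\le\tau_S$ and only the free server ($u_t=0$) for $t>\tau_S$, where $\tau_S=\inf\{t\ge0: x_t\ge S\}$. Then $\pi^S$ is $(D,\epsilon)$-feasible if $$S\ \ge\ S^*=\frac1{\alpha_0}\log\left(\frac1{\epsilon-e^{-\alpha_1D}}\right).$$ Moreover, $$\min_{S\ge S^*}J^{\pi^S}(D,\epsilon)=J^{\pi^{S^*}}(D,\epsilon)=\frac1{R_1-1}\left[\frac1{\alpha_0}\log\left(\frac1{\epsilon-e^{-\alpha_1D}}\right)-D+\xi\right]$$ for some $\xi\in[0,1)$.
   Context: Media streaming model with infinite file size. Let $R_0>1$, $R_c>0$, $R_1=R_0+R_c$. Let $N_t$ and $N^c_t$ be independent Poisson processes of rates $R_0$ (free server) and $R_c$ (costly server). With initial buffer size $D$ and actions $u_t\in\{0,1\}$ ($u_t=1$ if both servers are used at time $t$, $u_t=0$ if only the free one is used), the buffer size is $$x_t = D+N_t+\int_0^t u_\tau\, dN^c_\tau - t .$$ An online policy chooses $u_t$ from the history of buffer sizes and actions. The interruption probability of a policy $\pi$ is $p^\pi(D)=\mathbf P\{\exists\, t\ge 0:\ x_t\le 0\}$. The policy is $(D,\epsilon)$-feasible if $p^\pi(D)\le\epsilon$. The cost of a $(D,\epsilon)$-feasible policy is $J^\pi(D,\epsilon)=\mathbf E\big[\int_0^\infty u_t\,dt\big]$ (infeasible policies have infinite cost). For $R>1$ let $\bar r(R)=\sup\{r:\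 r+R(e^{-r}-1)=0\}$, and put $\alpha_0=\bar r(R_0)$, $\alpha_1=\bar r(R_1)$. Let $$\mathcal R=\Big\{(D,\epsilon):\ \epsilon\in(0,1),\ \tfrac1{\alpha_1}\log\tfrac1\epsilon\le D\le\tfrac1{\alpha_0}\log\tfrac1\epsilon\Big\}.$$ Convention: $\log(1/0)=+\infty$, so that $S^*=+\infty$ (and $\tau_{S^*}=+\infty$) when $\epsilon=e^{-\alpha_1D}$. *)

theory Defs
  imports "HOL-Probability.Probability"
begin

section \<open>Poisson processes\<close>

text \<open>The paths are nondecreasing, so the truncated subtraction of natural numbers
  is the true increment. Path properties are required of every sample path.\<close>

definition poisson_process :: "'a measure \<Rightarrow> real \<Rightarrow> (real \<Rightarrow> 'a \<Rightarrow> nat) \<Rightarrow> bool" where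
  "poisson_process M R N \<longleftrightarrow>
     (\<forall>t\<ge>0. N t \<in> measurable M (count_space UNIV)) \<and>
     (\<forall>\<omega>\<in>space M. N 0 \<omega> = 0 \<and> mono_on {0..} (\<lambda>t. N t \<omega>) \<and>
        (\<forall>t\<ge>0. continuous (at_right t) (\<lambda>s. real (N s \<omega>)))) \<and>
     (\<forall>s t. 0 \<le> s \<longrightarrow> s < t \<longrightarrow>
        distr M (count_space UNIV) (\<lambda>\<omega>. N t \<omega> - N s \<omega>) = measure_pmf (poisson_pmf (R * (t - s)))) \<and>
     (\<forall>(k::nat) t. 0 \<le> t 0 \<longrightarrow> mono t \<longrightarrow>
        prob_space.indep_vars M (\<lambda>_. count_space UNIV) (\<lambda>i \<omega>. N (t (Suc i)) \<omega> - N (t i) \<omega>) {..<k})"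

definition independent_processes ::
    "'a measure \<Rightarrow> (real \<Rightarrow> 'a \<Rightarrow> nat) \<Rightarrow> (real \<Rightarrow> 'a \<Rightarrow> nat) \<Rightarrow> bool" where
  "independent_processes M N N' \<longleftrightarrow>
     prob_space.indep_var M
       (Pi\<^sub>M {0..} (\<lambda>_. count_space UNIV)) (\<lambda>\<omega>. \<lambda>t\<in>{0..}. N t \<omega>)
       (Pi\<^sub>M {0..} (\<lambda>_. count_space UNIV)) (\<lambda>\<omega>. \<lambda>t\<in>{0..}. N' t \<omega>)"


section \<open>Policies and the buffer they generate\<close>

text \<open>A policy maps a buffer path, an action path and a time to an action. It is online if
  it takes values in \<open>{0, 1}\<close> and the action at time \<open>t\<close> depends only on the buffer sizes and
  actions before \<open>t\<close>; hence actions do not anticipate an arrival occurring at time \<open>t\<close> itself.\<close>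

type_synonym policy = "(real \<Rightarrow> real) \<Rightarrow> (real \<Rightarrow> real) \<Rightarrow> real \<Rightarrow> real"

definition online_policy :: "policy \<Rightarrow> bool" where
  "online_policy \<pi> \<longleftrightarrow>
     (\<forall>x u. \<forall>t\<ge>0. \<pi> x u t \<in> {0, 1}) \<and>
     (\<forall>x u x' u'. \<forall>t\<ge>0. (\<forall>s\<in>{0..<t}. x s = x' s \<and> u s = u' s) \<longrightarrow> \<pi> x u t = \<pi> x' u' t)"

text \<open>The Lebesgue--Stieltjes integral of \<open>u\<close> over \<open>(0, t]\<close> with respect to a counting path \<open>c\<close>
  on \<open>[0, \<infinity>)\<close>. The path is extended by \<open>c 0\<close> to negative times, as
  \<open>interval_measure\<close> takes a function on the whole real line.\<close>

definition path_integral :: "(real \<Rightarrow> real) \<Rightarrow> (real \<Rightarrow> nat) \<Rightarrow> real \<Rightarrow> real" where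
  "path_integral u c t =
     (LINT s:{0<..t}|interval_measure (\<lambda>s. real (c (max 0 s))). u s)"

text \<open>\<open>x\<close> and \<open>u\<close> are the buffer and action paths under policy \<open>\<pi>\<close>, when \<open>n\<close> and \<open>c\<close> are the
  arrival paths of the free and of the costly server.\<close>

definition closed_loop ::
    "real \<Rightarrow> (real \<Rightarrow> nat) \<Rightarrow> (real \<Rightarrow> nat) \<Rightarrow> policy \<Rightarrow> (real \<Rightarrow> real) \<Rightarrow> (real \<Rightarrow> real) \<Rightarrow> bool" where
  "closed_loop D n c \<pi> x u \<longleftrightarrow>
     (\<forall>t\<ge>0. u t = \<pi> x u t \<and> x t = D + real (n t) + path_integral u c t - t)"

text \<open>The choice below only matters up to values at negative times for policies whose
  closed loop is uniquely solvable; see \<open>ex_closed_loop_safe_policy\<close> and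
  \<open>closed_loop_safe_policy_unique\<close> below.\<close>

definition trajectory ::
    "real \<Rightarrow> (real \<Rightarrow> nat) \<Rightarrow> (real \<Rightarrow> nat) \<Rightarrow> policy \<Rightarrow> (real \<Rightarrow> real) \<times> (real \<Rightarrow> real)" where
  "trajectory D n c \<pi> = (SOME p. closed_loop D n c \<pi> (fst p) (snd p))"

definition buffer ::
    "(real \<Rightarrow> 'a \<Rightarrow> nat) \<Rightarrow> (real \<Rightarrow> 'a \<Rightarrow> nat) \<Rightarrow> real \<Rightarrow> policy \<Rightarrow> real \<Rightarrow> 'a \<Rightarrow> real" where
  "buffer N Nc D \<pi> t \<omega> = fst (trajectory D (\<lambda>s. N s \<omega>) (\<lambda>s. Nc s \<omega>) \<pi>) t"

definition action ::
    "(real \<Rightarrow> 'a \<Rightarrow> nat) \<Rightarrow> (real \<Rightarrow> 'a \<Rightarrow> nat) \<Rightarrow> real \<Rightarrow> policy \<Rightarrow> real \<Rightarrow> 'a \<Rightarrow> real" where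
  "action N Nc D \<pi> t \<omega> = snd (trajectory D (\<lambda>s. N s \<omega>) (\<lambda>s. Nc s \<omega>) \<pi>) t"

definition interruption_prob ::
    "'a measure \<Rightarrow> (real \<Rightarrow> 'a \<Rightarrow> nat) \<Rightarrow> (real \<Rightarrow> 'a \<Rightarrow> nat) \<Rightarrow> real \<Rightarrow> policy \<Rightarrow> real" where
  "interruption_prob M N Nc D \<pi> = \<P>(\<omega> in M. \<exists>t\<ge>0. buffer N Nc D \<pi> t \<omega> \<le> 0)"

definition feasible_policy ::
    "'a measure \<Rightarrow> (real \<Rightarrow> 'a \<Rightarrow> nat) \<Rightarrow> (real \<Rightarrow> 'a \<Rightarrow> nat) \<Rightarrow> real \<Rightarrow> real \<Rightarrow> policy \<Rightarrow> bool" where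
  "feasible_policy M N Nc D \<epsilon> \<pi> \<longleftrightarrow> online_policy \<pi> \<and> interruption_prob M N Nc D \<pi> \<le> \<epsilon>"

definition cost ::
    "'a measure \<Rightarrow> (real \<Rightarrow> 'a \<Rightarrow> nat) \<Rightarrow> (real \<Rightarrow> 'a \<Rightarrow> nat) \<Rightarrow> real \<Rightarrow> real \<Rightarrow> policy \<Rightarrow> ennreal" where
  "cost M N Nc D \<epsilon> \<pi> =
     (if feasible_policy M N Nc D \<epsilon> \<pi>
      then (\<integral>\<^sup>+ \<omega>. (\<integral>\<^sup>+ t\<in>{0..}. ennreal (action N Nc D \<pi> t \<omega>) \<partial>lborel) \<partial>M)
      else \<infinity>)"


section \<open>The online safe policy\<close>

definition hitting_time :: "ereal \<Rightarrow> (real \<Rightarrow> real) \<Rightarrow> ereal" where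
  "hitting_time S x = (INF t\<in>{t. 0 \<le> t \<and> S \<le> ereal (x t)}. ereal t)"

definition safe_policy :: "ereal \<Rightarrow> policy" where
  "safe_policy S x u t = (if ereal t \<le> hitting_time S x then 1 else 0)"

definition rbar :: "real \<Rightarrow> real" where
  "rbar R = Sup {r. r + R * (exp (- r) - 1) = 0}"

definition param_region :: "real \<Rightarrow> real \<Rightarrow> (real \<times> real) set" where
  "param_region \<alpha>0 \<alpha>1 =
     {(D, \<epsilon>). 0 < \<epsilon> \<and> \<epsilon> < 1 \<and> 1 / \<alpha>1 * ln (1 / \<epsilon>) \<le> D \<and> D \<le> 1 / \<alpha>0 * ln (1 / \<epsilon>)}"

text \<open>The convention \<open>log (1/0) = \<infinity>\<close> has to be made explicit, as \<open>ln (1/0) = 0\<close> in HOL.\<close>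

definition safe_threshold :: "real \<Rightarrow> real \<Rightarrow> real \<Rightarrow> real \<Rightarrow> ereal" where
  "safe_threshold \<alpha>0 \<alpha>1 D \<epsilon> =
     (if \<epsilon> = exp (- \<alpha>1 * D) then \<infinity>
      else ereal (1 / \<alpha>0 * ln (1 / (\<epsilon> - exp (- \<alpha>1 * D)))))"


section \<open>The safe policy is online and its closed loop is uniquely solvable\<close>

lemma hitting_time_greaterD: "ereal s < hitting_time S x \<Longrightarrow> 0 \<le> s \<Longrightarrow> ereal (x s) < S"
  unfolding hitting_time_def
  by (metis (mono_tags, lifting) INF_lower leD le_less_linear mem_Collect_eq)

lemma hitting_time_nonneg: "0 \<le> hitting_time S x"
  unfolding hitting_time_def by (rule INF_greatest) auto

lemma le_hitting_time_iff:
  "ereal t \<le> hitting_time S x \<longleftrightarrow> (\<forall>s\<in>{0..<t}. ereal (x s) < S)"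
proof
  assume "ereal t \<le> hitting_time S x"
  then show "\<forall>s\<in>{0..<t}. ereal (x s) < S"
    by (metis atLeastLessThan_iff ereal_less(2) hitting_time_greaterD less_ereal.simps(1) less_le_trans)
next
  assume *: "\<forall>s\<in>{0..<t}. ereal (x s) < S"
  show "ereal t \<le> hitting_time S x"
    unfolding hitting_time_def
  proof (rule INF_greatest)
    fix s assume "s \<in> {s. 0 \<le> s \<and> S \<le> ereal (x s)}"
    then have "\<not> s < t" using * by (auto simp: not_le[symmetric])
    then show "ereal t \<le> ereal s" by simp
  qed
qed

lemma online_safe_policy: "online_policy (safe_policy S)"
  unfolding online_policy_def safe_policy_def le_hitting_time_iff by auto

lemma hitting_time_attained:
  assumes T: "hitting_time S x = ereal T" and rc: "continuous (at_right T) x"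
  shows "S \<le> ereal (x T)"
proof (rule ccontr)
  assume "\<not> S \<le> ereal (x T)"
  then have less: "ereal (x T) < S" by simp
  have T0: "0 \<le> T" using hitting_time_nonneg[of S x] T by simp
  have "((\<lambda>s. ereal (x s)) \<longlongrightarrow> ereal (x T)) (at_right T)"
    using rc by (simp add: continuous_within)
  then have "\<forall>\<^sub>F s in at_right T. ereal (x s) < S"
    using less by (rule order_tendstoD(2))
  then obtain b where b: "b > T" "\<And>s. T < s \<Longrightarrow> s < b \<Longrightarrow> ereal (x s) < S"
    unfolding eventually_at_right_field by blast
  have "\<forall>s\<in>{0..<b}. ereal (x s) < S"
  proof
    fix s assume s: "s \<in> {0..<b}"
    consider "s < T" | "s = T" | "T < s" by linarith
    then show "ereal (x s) < S"
    proof cases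
      case 1
      then show ?thesis using hitting_time_greaterD[of s S x] s T by simp
    qed (use less b s in auto)
  qed
  then have "ereal b \<le> hitting_time S x" by (simp add: le_hitting_time_iff)
  then show False using b T by simp
qed

lemma hitting_time_cong:
  assumes rc: "\<And>t. 0 \<le> t \<Longrightarrow> continuous (at_right t) x"
    and eq: "\<And>t. 0 \<le> t \<Longrightarrow> ereal t \<le> hitting_time S x \<Longrightarrow> x' t = x t"
  shows "hitting_time S x' = hitting_time S x"
proof (rule antisym)
  show "hitting_time S x' \<le> hitting_time S x"
  proof (cases "hitting_time S x")
    case (real T)
    have T0: "0 \<le> T" using hitting_time_nonneg[of S x] real by simp
    have "S \<le> ereal (x' T)"
      using hitting_time_attained[OF real rc[OF T0]] eq[OF T0] real by simp
    then show ?thesis unfolding real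
      by (subst hitting_time_def) (use T0 in \<open>auto intro: INF_lower\<close>)
  qed (use hitting_time_nonneg[of S x] in auto)
  show "hitting_time S x \<le> hitting_time S x'"
    unfolding hitting_time_def[of S x']
  proof (rule INF_greatest)
    fix s assume "s \<in> {s. 0 \<le> s \<and> S \<le> ereal (x' s)}"
    then have s: "0 \<le> s" "S \<le> ereal (x' s)" by auto
    show "hitting_time S x \<le> ereal s"
    proof (rule ccontr)
      assume "\<not> hitting_time S x \<le> ereal s"
      then have "ereal s < hitting_time S x" by simp
      then show False using hitting_time_greaterD[of s S x] eq[of s] s by simp
    qed
  qed
qed

lemma path_integral_safe_policy:
  assumes c: "mono_on {0..} c" "\<And>t. 0 \<le> t \<Longrightarrow> continuous (at_right t) (\<lambda>s. real (c s))"
    and u: "\<And>s. 0 \<le> s \<Longrightarrow> u s = (if ereal s \<le> T then 1 else 0)" and T: "0 \<le> T" and t: "0 \<le> t"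
  shows "path_integral u c t = real (c (real_of_ereal (min (ereal t) T))) - real (c 0)"
proof -
  let ?F = "\<lambda>s. real (c (max 0 s))"
  let ?m = "real_of_ereal (min (ereal t) T)"
  have m: "0 \<le> ?m" "ereal ?m = min (ereal t) T"
    using T t by (cases T; auto simp: min_def)+
  have mono: "?F x \<le> ?F y" if "x \<le> y" for x y
    using that mono_onD[OF c(1), of "max 0 x" "max 0 y"] by (simp add: max_def)
  have cont: "continuous (at_right a) ?F" for a
  proof (cases "0 \<le> a")
    case True
    have "\<forall>\<^sub>F s in at_right a. real (c s) = ?F s"
      unfolding eventually_at_right_field by (rule exI[of _ "a + 1"]) (use True in auto)
    then show ?thesis
      using Lim_transform_eventually[of "\<lambda>s. real (c s)" "real (c a)" "at_right a" ?F] c(2)[OF True] True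
      by (simp add: continuous_within max_absorb2)
  next
    case False
    then have "\<forall>\<^sub>F s in at_right a. real (c 0) = ?F s"
      unfolding eventually_at_right_field by (intro exI[of _ 0]) auto
    then have "(?F \<longlongrightarrow> real (c 0)) (at_right a)"
      by (rule Lim_transform_eventually[OF tendsto_const])
    then show ?thesis using False by (simp add: continuous_within)
  qed
  have "(indicator {0<..t} s *\<^sub>R u s) = indicat_real {0<..?m} s" for s
  proof -
    have "ereal s \<le> min (ereal t) T \<longleftrightarrow> s \<le> ?m" by (metis m(2) ereal_less_eq(3))
    then show ?thesis using u[of s] by (auto simp: indicator_def)
  qed
  then have "path_integral u c t = measure (interval_measure ?F) {0<..?m}"
    unfolding path_integral_def set_lebesgue_integral_def by simp
  also have "\<dots> = ?F ?m - ?F 0"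
    by (rule measure_interval_measure_Ioc) (use m mono cont in auto)
  finally show ?thesis using m by simp
qed

context
  fixes n c :: "real \<Rightarrow> nat" and D :: real
  assumes n: "\<And>t. 0 \<le> t \<Longrightarrow> continuous (at_right t) (\<lambda>s. real (n s))"
    and c: "c 0 = 0" "mono_on {0..} c" "\<And>t. 0 \<le> t \<Longrightarrow> continuous (at_right t) (\<lambda>s. real (c s))"
begin

lemma ex_closed_loop_safe_policy: "\<exists>x u. closed_loop D n c (safe_policy S) x u"
proof -
  define y where "y = (\<lambda>t. D + real (n t) + real (c t) - t)"
  define T where "T = hitting_time S y"
  define u where "u = (\<lambda>t. if ereal t \<le> T then 1 else 0 :: real)"
  define x where "x = (\<lambda>t. D + real (n t) + path_integral u c t - t)"
  have T0: "0 \<le> T" by (simp add: T_def hitting_time_nonneg)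
  have "hitting_time S x = T" unfolding T_def
  proof (rule hitting_time_cong)
    show "continuous (at_right t) y" if "0 \<le> t" for t
      unfolding y_def by (intro continuous_intros n c(3) that)
    show "x t = y t" if "0 \<le> t" "ereal t \<le> hitting_time S y" for t
      using path_integral_safe_policy[of c u T t, OF c(2,3)] T0 that c(1)
      by (simp add: u_def x_def y_def T_def min_absorb1)
  qed
  then have "closed_loop D n c (safe_policy S) x u"
    unfolding closed_loop_def safe_policy_def by (simp add: u_def x_def)
  then show ?thesis by blast
qed

lemma closed_loop_safe_policy:
  assumes xu: "closed_loop D n c (safe_policy S) x u" and t: "0 \<le> t"
  defines "T \<equiv> hitting_time S (\<lambda>t. D + real (n t) + real (c t) - t)"
  shows "u t = (if ereal t \<le> T then 1 else 0)"
    and "x t = D + real (n t) + real (c (real_of_ereal (min (ereal t) T))) - t"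
proof -
  define y where "y = (\<lambda>t. D + real (n t) + real (c t) - t)"
  define T' where "T' = hitting_time S x"
  have T'0: "0 \<le> T'" by (simp add: T'_def hitting_time_nonneg)
  have u: "u s = (if ereal s \<le> T' then 1 else 0)" if "0 \<le> s" for s
    using xu that by (auto simp: closed_loop_def safe_policy_def T'_def)
  have x: "x s = D + real (n s) + real (c (real_of_ereal (min (ereal s) T'))) - s" if "0 \<le> s" for s
    using xu that path_integral_safe_policy[of c u T' s, OF c(2,3) u T'0 that] c(1)
    by (simp add: closed_loop_def)
  have agree: "y s = x s" if "0 \<le> s" "ereal s \<le> T'" for s
    using x[of s] that by (simp add: y_def min_absorb1)
  have cy: "continuous (at_right s) y" if "0 \<le> s" for s
    unfolding y_def by (intro continuous_intros n c(3) that)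
  have "hitting_time S y = T'"
  proof (rule antisym)
    show "T' \<le> hitting_time S y"
    proof (rule ccontr)
      assume "\<not> T' \<le> hitting_time S y"
      then have less: "hitting_time S y < T'" by simp
      then obtain s where s: "hitting_time S y = ereal s"
        using hitting_time_nonneg[of S y] by (cases "hitting_time S y") auto
      have s0: "0 \<le> s" using hitting_time_nonneg[of S y] s by simp
      have "S \<le> ereal (y s)" by (rule hitting_time_attained[OF s cy[OF s0]])
      then show False
        using hitting_time_greaterD[of s S x] agree[OF s0] less s s0 by (simp add: T'_def)
    qed
    show "hitting_time S y \<le> T'"
    proof (cases T')
      case (real r)
      have r0: "0 \<le> r" using T'0 real by simp
      have "continuous (at_right r) (\<lambda>s. D + real (n s) + real (c r) - s)"
        by (intro continuous_intros n r0)
      moreover have "\<forall>\<^sub>F s in at_right r. D + real (n s) + real (c r) - s = x s"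
        unfolding eventually_at_right_field
        by (rule exI[of _ "r + 1"]) (use x r0 real in \<open>auto simp: min_absorb2\<close>)
      moreover have "x r = D + real (n r) + real (c r) - r" using x[OF r0] real by simp
      ultimately have "continuous (at_right r) x"
        by (simp add: continuous_within) (rule Lim_transform_eventually)
      then have "S \<le> ereal (x r)"
        by (rule hitting_time_attained[OF real[unfolded T'_def]])
      then have "S \<le> ereal (y r)" using agree[OF r0] real by simp
      then show ?thesis unfolding real
        by (subst hitting_time_def) (use r0 in \<open>auto intro: INF_lower\<close>)
    qed (use T'0 in auto)
  qed
  then have "T = T'" by (simp add: T_def y_def)
  then show "u t = (if ereal t \<le> T then 1 else 0)"
    and "x t = D + real (n t) + real (c (real_of_ereal (min (ereal t) T))) - t"
    using u[OF t] x[OF t] by auto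
qed

corollary closed_loop_safe_policy_unique:
  assumes "closed_loop D n c (safe_policy S) x u" "closed_loop D n c (safe_policy S) x' u'" "0 \<le> t"
  shows "x t = x' t \<and> u t = u' t"
  using closed_loop_safe_policy[OF assms(1,3)] closed_loop_safe_policy[OF assms(2,3)] by simp

end

end

theory Submission
  imports Defs
begin

text \<open>Until the threshold is hit the buffer \<open>x\<close> moves with both servers, afterwards with the free one
  only. As \<open>\<alpha>1\<close> and \<open>\<alpha>0\<close> are the exponents for which \<open>exp (- \<alpha> x)\<close> is a martingale in the two
  phases, the potential that equals \<open>exp (- \<alpha>1 x) + exp (- \<alpha>0 S)\<close> in the first phase, \<open>exp (- \<alpha>0 x)\<close> in
  the second and \<open>1\<close> after an interruption is a supermartingale, which bounds the interruption
  probability by \<open>exp (- \<alpha>1 D) + exp (- \<alpha>0 S)\<close>. The cost is the expected hitting time of \<open>S\<close>; by Wald's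
  identity it is \<open>1 / (R1 - 1)\<close> times the expected climb, which is \<open>S - D\<close> plus the overshoot \<open>\<xi>\<close>, and
  the overshoot is below \<open>1\<close> because arrivals almost surely come one at a time.

  Optional stopping is applied only along the grids of mesh \<open>h = 1 / 2 ^ m\<close>, where the independent
  increments give a countable Markov chain. There the costly server is switched off at the first grid
  time with \<open>x + h \<ge> S\<close>: between grid times the buffer loses at most \<open>h\<close>, so this never misses the hit,
  and for small \<open>h\<close> (depending on the path) it is not early either.\<close>

section \<open>The exponents and moments of the Poisson distribution\<close>

lemma rbar_root:
  assumes "R > 1"
  shows "rbar R > 0" and "rbar R + R * (exp (- rbar R) - 1) = 0"
proof -
  define A where "A = {r. r + R * (exp (- r) - 1) = 0}"
  have bdd: "bdd_above A"
  proof (rule bdd_aboveI)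
    fix r assume "r \<in> A"
    then have "r = R - R * exp (- r)" by (simp add: A_def algebra_simps)
    also have "\<dots> \<le> R" using assms by simp
    finally show "r \<le> R" .
  qed
  have "closed A" unfolding A_def by (intro closed_Collect_eq continuous_intros)
  moreover have "0 \<in> A" by (simp add: A_def)
  ultimately have "Sup A \<in> A" using bdd by (intro closed_contains_Sup) auto
  then show "rbar R + R * (exp (- rbar R) - 1) = 0" by (simp add: rbar_def A_def)
  have "ln R \<noteq> R - 1" using assms ln_eq_minus_one[of R] by auto
  then have "ln R < R - 1" using ln_le_minus_one[of R] assms by simp
  then have neg: "ln R + R * (exp (- ln R) - 1) \<le> 0"
    using assms by (simp add: exp_minus right_diff_distrib)
  have "\<exists>r\<ge>ln R. r \<le> R \<and> r + R * (exp (- r) - 1) = 0"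
  proof (rule IVT)
    show "ln R \<le> R" using \<open>ln R < R - 1\<close> by simp
    show "0 \<le> R + R * (exp (- R) - 1)" using assms by (simp add: algebra_simps)
    show "\<forall>x. ln R \<le> x \<and> x \<le> R \<longrightarrow> isCont (\<lambda>r. r + R * (exp (- r) - 1)) x"
      by (intro allI impI continuous_intros)
  qed (rule neg)
  then obtain r where r: "ln R \<le> r" "r \<in> A" by (auto simp: A_def)
  have "0 < ln R" using assms by simp
  then have "0 < r" using r by simp
  also have "r \<le> Sup A" using r bdd by (intro cSup_upper)
  finally show "rbar R > 0" by (simp add: rbar_def A_def)
qed

lemma nn_integral_poisson_exp:
  assumes "0 < l"
  shows "(\<integral>\<^sup>+ n. ennreal (exp (- a * real n)) \<partial>measure_pmf (poisson_pmf l)) = ennreal (exp (l * (exp (- a) - 1)))"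
proof -
  have "(\<lambda>n. (l * exp (- a)) ^ n /\<^sub>R fact n) sums exp (l * exp (- a))"
    by (rule exp_converges)
  then have "(\<lambda>n. exp (- l) * ((l * exp (- a)) ^ n /\<^sub>R fact n)) sums (exp (- l) * exp (l * exp (- a)))"
    by (rule sums_mult)
  moreover have "exp (- l) * ((l * exp (- a)) ^ n /\<^sub>R fact n)
      = pmf (poisson_pmf l) n * exp (- a * real n)" for n
    using assms by (simp add: power_mult_distrib exp_of_nat_mult[symmetric] field_simps)
  ultimately have s: "(\<lambda>n. pmf (poisson_pmf l) n * exp (- a * real n)) sums exp (l * (exp (- a) - 1))"
    by (simp add: exp_add[symmetric] algebra_simps)
  have "(\<integral>\<^sup>+ n. ennreal (exp (- a * real n)) \<partial>measure_pmf (poisson_pmf l))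
     = (\<integral>\<^sup>+ n. ennreal (pmf (poisson_pmf l) n) * ennreal (exp (- a * real n)) \<partial>count_space UNIV)"
    by (rule nn_integral_measure_pmf)
  also have "\<dots> = (\<Sum>n. ennreal (pmf (poisson_pmf l) n * exp (- a * real n)))"
    by (simp add: nn_integral_count_space_nat ennreal_mult)
  also have "\<dots> = ennreal (exp (l * (exp (- a) - 1)))"
    using s by (simp add: suminf_ennreal2 sums_iff)
  finally show ?thesis .
qed

lemma nn_integral_poisson_mean:
  assumes "0 < l"
  shows "(\<integral>\<^sup>+ n. ennreal (real n) \<partial>measure_pmf (poisson_pmf l)) = ennreal l"
proof -
  have eq: "pmf (poisson_pmf l) (Suc n) * real (Suc n) = exp (- l) * l * (l ^ n /\<^sub>R fact n)" for n
    using assms by (simp add: field_simps del: of_nat_Suc)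
  have "(\<lambda>n. l ^ n /\<^sub>R fact n) sums exp l" by (rule exp_converges)
  then have "(\<lambda>n. exp (- l) * l * (l ^ n /\<^sub>R fact n)) sums (exp (- l) * l * exp l)"
    by (rule sums_mult)
  then have "(\<lambda>n. pmf (poisson_pmf l) (Suc n) * real (Suc n)) sums l"
    unfolding eq by (simp add: exp_minus field_simps)
  then have s: "(\<lambda>n. pmf (poisson_pmf l) n * real n) sums l"
    by (subst (asm) sums_Suc_iff) simp
  have "(\<integral>\<^sup>+ n. ennreal (real n) \<partial>measure_pmf (poisson_pmf l))
     = (\<integral>\<^sup>+ n. ennreal (pmf (poisson_pmf l) n) * ennreal (real n) \<partial>count_space UNIV)"
    by (rule nn_integral_measure_pmf)
  also have "\<dots> = (\<Sum>n. ennreal (pmf (poisson_pmf l) n * real n))"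
    by (simp add: nn_integral_count_space_nat ennreal_mult)
  also have "\<dots> = ennreal l"
    using s by (simp add: suminf_ennreal2 sums_iff)
  finally show ?thesis .
qed

lemma poisson_ge1:
  assumes "0 < l"
  shows "measure (measure_pmf (poisson_pmf l)) {1..} \<le> l"
proof -
  have "measure (measure_pmf (poisson_pmf l)) {1..} = 1 - measure (measure_pmf (poisson_pmf l)) {0}"
    by (subst measure_pmf.prob_compl[symmetric]) (auto intro!: arg_cong[where f="measure _"])
  also have "\<dots> = 1 - exp (- l)" using assms by (simp add: measure_pmf_single)
  also have "\<dots> \<le> l" using exp_ge_add_one_self[of "- l"] by simp
  finally show ?thesis .
qed

lemma poisson_ge2:
  assumes "0 < l"
  shows "measure (measure_pmf (poisson_pmf l)) {2..} \<le> l\<^sup>2"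
proof -
  have "measure (measure_pmf (poisson_pmf l)) {2..} = 1 - measure (measure_pmf (poisson_pmf l)) {0, 1}"
    by (subst measure_pmf.prob_compl[symmetric]) (auto intro!: arg_cong[where f="measure _"])
  also have "measure (measure_pmf (poisson_pmf l)) {0, 1} = exp (- l) * (1 + l)"
    using assms by (subst measure_measure_pmf_finite) (auto simp: algebra_simps)
  also have "1 - exp (- l) * (1 + l) \<le> 1 - (1 - l) * (1 + l)"
    using mult_right_mono[OF exp_ge_add_one_self[of "- l"], of "1 + l"] assms by simp
  finally show ?thesis by (simp add: algebra_simps power2_eq_square)
qed

section \<open>Paths along dyadic grids\<close>

lemma right_continuous_nat_const:
  fixes f :: "real \<Rightarrow> nat"
  assumes "continuous (at_right t) (\<lambda>s. real (f s))"
  obtains b where "b > t" "\<And>s. t \<le> s \<Longrightarrow> s < b \<Longrightarrow> f s = f t"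
proof -
  have "\<forall>\<^sub>F s in at_right t. dist (real (f s)) (real (f t)) < 1"
    using assms by (simp add: continuous_within tendstoD)
  then obtain b where b: "b > t" "\<And>s. t < s \<Longrightarrow> s < b \<Longrightarrow> dist (real (f s)) (real (f t)) < 1"
    unfolding eventually_at_right_field by blast
  show ?thesis
  proof (rule that[OF b(1)])
    fix s assume "t \<le> s" "s < b"
    then show "f s = f t" using b(2)[of s] by (cases "s = t") (auto simp: dist_real_def)
  qed
qed

lemma less_nat_ceiling_div_iff:
  assumes "h > 0"
  shows "i < nat \<lceil>T / h\<rceil> \<longleftrightarrow> real i * h < T"
  using assms by (simp add: zless_nat_eq_int_zless less_ceiling_iff field_simps)

lemma nat_ceiling_div_mult_bounds:
  assumes "h > 0" "T \<ge> 0"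
  shows "T \<le> real (nat \<lceil>T / h\<rceil>) * h" "real (nat \<lceil>T / h\<rceil>) * h < T + h"
proof -
  have "0 \<le> T / h" using assms by simp
  then have *: "real (nat \<lceil>T / h\<rceil>) = of_int \<lceil>T / h\<rceil>" by simp
  have "T / h \<le> of_int \<lceil>T / h\<rceil>" "of_int \<lceil>T / h\<rceil> < T / h + 1"
    by linarith+
  then show "T \<le> real (nat \<lceil>T / h\<rceil>) * h" "real (nat \<lceil>T / h\<rceil>) * h < T + h"
    unfolding * using assms(1) by (simp_all only: pos_divide_le_eq) (simp add: field_simps)
qed

lemma sum_stopped_increments:
  fixes f :: "real \<Rightarrow> real"
  assumes "h > 0" "T \<le> real k * h"
  shows "(\<Sum>i<k. if real i * h < T then f (real (Suc i) * h) - f (real i * h) else 0)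
    = f (real (nat \<lceil>T / h\<rceil>) * h) - f 0"
proof -
  let ?m = "nat \<lceil>T / h\<rceil>"
  have m: "?m \<le> k"
    using less_nat_ceiling_div_iff[of h k T] assms by (simp add: not_less[symmetric])
  have "(\<Sum>i<k. if real i * h < T then f (real (Suc i) * h) - f (real i * h) else 0)
    = (\<Sum>i\<in>{..<k} \<inter> {i. i < ?m}. f (real (Suc i) * h) - f (real i * h))"
    unfolding less_nat_ceiling_div_iff[OF assms(1)] by (subst sum.inter_restrict) auto
  also have "{..<k} \<inter> {i. i < ?m} = {..<?m}" using less_le_trans[OF _ m] by blast
  also have "(\<Sum>i<?m. f (real (Suc i) * h) - f (real i * h)) = f (real ?m * h) - f (real 0 * h)"
    by (rule sum_lessThan_telescope)
  finally show ?thesis by simp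
qed

lemma tendsto_half_power: "(\<lambda>m. (1/2::real) ^ m) \<longlonglongrightarrow> 0"
  by (rule LIMSEQ_power_zero) simp

lemma eventually_half_power_le:
  assumes "\<delta> > 0"
  shows "\<forall>\<^sub>F m in sequentially. (1/2::real) ^ m \<le> \<delta>"
  using order_tendstoD(2)[OF tendsto_half_power assms] by eventually_elim simp

lemma tendsto_dyadic_ceiling:
  assumes "T \<ge> 0"
  shows "(\<lambda>m. real (nat \<lceil>T / (1/2) ^ m\<rceil>) * (1/2) ^ m) \<longlonglongrightarrow> T"
proof -
  have lower: "\<forall>\<^sub>F m in sequentially. T \<le> real (nat \<lceil>T / (1/2) ^ m\<rceil>) * (1/2) ^ m"
    by (intro always_eventually allI nat_ceiling_div_mult_bounds(1) assms) simp
  have upper: "\<forall>\<^sub>F m in sequentially. real (nat \<lceil>T / (1/2) ^ m\<rceil>) * (1/2) ^ m \<le> T + (1/2::real) ^ m"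
    by (intro always_eventually allI less_imp_le nat_ceiling_div_mult_bounds(2) assms) simp
  have "(\<lambda>m. T + (1/2::real) ^ m) \<longlonglongrightarrow> T"
    using tendsto_add[OF tendsto_const tendsto_half_power, of T] by simp
  then show ?thesis by (rule tendsto_sandwich[OF lower upper tendsto_const])
qed

lemma eventually_dyadic_ceiling:
  assumes "T \<ge> 0" "b > T"
  shows "\<forall>\<^sub>F m in sequentially. T \<le> real (nat \<lceil>T / (1/2) ^ m\<rceil>) * (1/2) ^ m
    \<and> real (nat \<lceil>T / (1/2) ^ m\<rceil>) * (1/2) ^ m < b"
  using order_tendstoD(2)[OF tendsto_dyadic_ceiling[OF assms(1)] assms(2)]
  by eventually_elim (use nat_ceiling_div_mult_bounds[OF _ assms(1)] in auto)

lemma eventually_dyadic_ceiling_eq: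
  fixes f :: "real \<Rightarrow> nat"
  assumes "T \<ge> 0" "continuous (at_right T) (\<lambda>s. real (f s))"
  shows "\<forall>\<^sub>F m in sequentially. f (real (nat \<lceil>T / (1/2) ^ m\<rceil>) * (1/2) ^ m) = f T"
proof -
  obtain b where b: "b > T" "\<And>s. T \<le> s \<Longrightarrow> s < b \<Longrightarrow> f s = f T"
    by (rule right_continuous_nat_const[OF assms(2)]) blast
  show ?thesis using eventually_dyadic_ceiling[OF assms(1) b(1)]
    by (rule eventually_mono) (use b(2) in blast)
qed

locale buffer_path =
  fixes n c :: "real \<Rightarrow> nat" and D :: real and S :: ereal
  assumes n0: "n 0 = 0" and n_mono: "mono_on {0..} n"
    and n_cont: "\<And>t. 0 \<le> t \<Longrightarrow> continuous (at_right t) (\<lambda>s. real (n s))"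
    and c0: "c 0 = 0" and c_mono: "mono_on {0..} c"
    and c_cont: "\<And>t. 0 \<le> t \<Longrightarrow> continuous (at_right t) (\<lambda>s. real (c s))"
begin

definition y :: "real \<Rightarrow> real" where
  "y t = D + real (n t) + real (c t) - t"

definition hit :: ereal where
  "hit = hitting_time S y"

definition on :: "real \<Rightarrow> nat \<Rightarrow> bool" where
  "on h j \<longleftrightarrow> (\<forall>i\<le>j. ereal (y (real i * h) + h) < S)"

definition grid_buffer :: "real \<Rightarrow> nat \<Rightarrow> real" where
  "grid_buffer h k = D + real (n (real k * h))
     + (\<Sum>i<k. if on h i then real (c (real (Suc i) * h)) - real (c (real i * h)) else 0) - real k * h"

lemma hit_nonneg: "0 \<le> hit"
  by (simp add: hit_def hitting_time_nonneg)

lemma y_cont: "0 \<le> t \<Longrightarrow> continuous (at_right t) y"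
  unfolding y_def[abs_def] by (intro continuous_intros n_cont c_cont)

lemma y_drop: "0 \<le> s \<Longrightarrow> s \<le> t \<Longrightarrow> y s - (t - s) \<le> y t"
  using mono_onD[OF n_mono, of s t] mono_onD[OF c_mono, of s t] by (simp add: y_def)

lemma y_below_before_hit: "0 \<le> s \<Longrightarrow> ereal s < hit \<Longrightarrow> ereal (y s) < S"
  unfolding hit_def by (rule hitting_time_greaterD)

lemma y_at_hit: "hit = ereal T \<Longrightarrow> S \<le> ereal (y T)"
  using hit_nonneg by (intro hitting_time_attained y_cont) (auto simp: hit_def)

text \<open>On \<open>[0, T)\<close> the buffer attains, for each of the finitely many values of the arrival count, its
  maximum at the first time with that count. So the supremum on \<open>[0, T)\<close> is attained.\<close>

lemma uniformly_below_threshold: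
  assumes below: "\<And>s. 0 \<le> s \<Longrightarrow> s < T \<Longrightarrow> ereal (y s) < S"
  shows "\<exists>\<delta>>0. \<forall>s. 0 \<le> s \<longrightarrow> s < T \<longrightarrow> ereal (y s + \<delta>) < S"
proof -
  define m where "m s = n s + c s" for s
  have m_mono: "m s \<le> m t" if "0 \<le> s" "s \<le> t" for s t
    using mono_onD[OF n_mono, of s t] mono_onD[OF c_mono, of s t] that by (simp add: m_def)
  have level: "\<exists>\<delta>>0. \<forall>s. 0 \<le> s \<longrightarrow> s < T \<longrightarrow> m s = j \<longrightarrow> ereal (y s + \<delta>) < S" for j
  proof (cases "\<exists>s. 0 \<le> s \<and> s < T \<and> m s = j")
    case True
    define A where "A = {s. 0 \<le> s \<and> s < T \<and> m s = j}"
    define r where "r = Inf A"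
    have ne: "A \<noteq> {}" and bdd: "bdd_below A"
      using True by (auto simp: A_def intro!: bdd_belowI[of _ 0])
    have lower: "r \<le> s" if "s \<in> A" for s unfolding r_def by (rule cInf_lower[OF that bdd])
    have r0: "0 \<le> r" unfolding r_def by (rule cInf_greatest[OF ne]) (auto simp: A_def)
    have rT: "r < T" using ne lower by (force simp: A_def)
    have "continuous (at_right r) (\<lambda>s. real (m s))"
      unfolding m_def of_nat_add by (intro continuous_intros n_cont c_cont r0)
    then obtain b where b: "b > r" "\<And>s. r \<le> s \<Longrightarrow> s < b \<Longrightarrow> m s = m r"
      by (rule right_continuous_nat_const) blast
    obtain s where s: "s \<in> A" "s < b"
      using b(1) cInf_lessD[OF ne, of b] by (auto simp: r_def)
    have mr: "m r = j" using b(2)[OF lower[OF s(1)] s(2)] s(1) by (simp add: A_def)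
    have le: "y s \<le> y r" if "s \<in> A" for s
    proof -
      have "real (m s) = real (m r)" using that mr by (simp add: A_def)
      then show ?thesis using lower[OF that] by (simp add: y_def m_def)
    qed
    have "ereal (y r) < S" using below r0 rT by simp
    then obtain z where z: "ereal (y r) < ereal z" "ereal z < S" using ereal_dense2 by blast
    show ?thesis
    proof (intro exI[of _ "z - y r"] conjI allI impI)
      show "0 < z - y r" using z(1) by simp
      fix s assume "0 \<le> s" "s < T" "m s = j"
      then have "y s \<le> y r" using le by (simp add: A_def)
      then have "ereal (y s + (z - y r)) \<le> ereal z" by simp
      then show "ereal (y s + (z - y r)) < S" using z(2) by (rule le_less_trans)
    qed
  qed (auto intro: exI[of _ 1])
  then obtain d where d: "\<And>j. d j > 0"
    "\<And>j s. 0 \<le> s \<Longrightarrow> s < T \<Longrightarrow> m s = j \<Longrightarrow> ereal (y s + d j) < S"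
    by metis
  define \<delta> where "\<delta> = Min (d ` {..m T})"
  show ?thesis
  proof (intro exI[of _ \<delta>] conjI allI impI)
    show "\<delta> > 0" unfolding \<delta>_def using d(1) by (subst Min_gr_iff) auto
    fix s assume s: "0 \<le> s" "s < T"
    have "\<delta> \<le> d (m s)" unfolding \<delta>_def using m_mono s by (intro Min_le) auto
    then have "ereal (y s + \<delta>) \<le> ereal (y s + d (m s))" by simp
    then show "ereal (y s + \<delta>) < S" using d(2)[OF s refl] by (rule le_less_trans)
  qed
qed

lemma on_iff_before_hit:
  "\<exists>\<delta>>0. \<forall>h. 0 < h \<and> h \<le> \<delta> \<longrightarrow> (\<forall>j. real j * h < K \<longrightarrow> on h j \<longleftrightarrow> ereal (real j * h) < hit)"
proof -
  define T where "T = real_of_ereal (min hit (ereal K))"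
  have T: "ereal T = min hit (ereal K)"
    unfolding T_def using hit_nonneg by (cases hit) (auto simp: min_def)
  have "ereal (y s) < S" if "0 \<le> s" "s < T" for s
  proof (rule y_below_before_hit[OF that(1)])
    have "ereal s < ereal T" using that by simp
    then show "ereal s < hit" unfolding T by simp
  qed
  then obtain \<delta> where \<delta>: "\<delta> > 0" "\<And>s. 0 \<le> s \<Longrightarrow> s < T \<Longrightarrow> ereal (y s + \<delta>) < S"
    using uniformly_below_threshold[of T] by blast
  show ?thesis
  proof (intro exI[of _ \<delta>] conjI allI impI \<delta>(1))
    fix h :: real and j :: nat
    assume h: "0 < h \<and> h \<le> \<delta>" and jK: "real j * h < K"
    show "on h j \<longleftrightarrow> ereal (real j * h) < hit"
    proof
      assume less: "ereal (real j * h) < hit"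
      have "ereal (real j * h) < ereal T" unfolding T using less jK by simp
      then have jT: "real j * h < T" by simp
      show "on h j" unfolding on_def
      proof (intro allI impI)
        fix i assume "i \<le> j"
        then have "real i * h < T" using jT h by (meson le_less_trans mult_right_mono of_nat_mono less_imp_le)
        then have "ereal (y (real i * h) + \<delta>) < S" using h by (intro \<delta>(2)) auto
        then show "ereal (y (real i * h) + h) < S"
          using h by (intro le_less_trans[of "ereal (y (real i * h) + h)" "ereal (y (real i * h) + \<delta>)"]) auto
      qed
    next
      assume on: "on h j"
      show "ereal (real j * h) < hit"
      proof (rule ccontr)
        assume "\<not> ereal (real j * h) < hit"
        then obtain r where r: "hit = ereal r" "0 \<le> r" "r \<le> real j * h"
          using hit_nonneg by (cases hit) auto
        let ?i = "nat \<lceil>r / h\<rceil>"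
        have i: "r \<le> real ?i * h" "real ?i * h < r + h"
          using nat_ceiling_div_mult_bounds[of h r] h r by auto
        have "?i \<le> j" using less_nat_ceiling_div_iff[of h j r] h r by (simp add: not_less[symmetric])
        then have "ereal (y (real ?i * h) + h) < S" using on by (simp add: on_def)
        moreover have "y r \<le> y (real ?i * h) + h" using y_drop[OF r(2) i(1)] i(2) by simp
        ultimately have "ereal (y r) < S" by (meson ereal_less_eq(3) le_less_trans)
        then show False using y_at_hit[OF r(1)] by simp
      qed
    qed
  qed
qed

lemma eventually_sum_on:
  fixes f :: "real \<Rightarrow> real"
  assumes "0 \<le> K"
  defines "T \<equiv> real_of_ereal (min hit (ereal K))"
  shows "\<forall>\<^sub>F m in sequentially. \<forall>k. real k * (1/2) ^ m = K \<longrightarrow>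
    (\<Sum>i<k. if on ((1/2) ^ m) i then f (real (Suc i) * (1/2) ^ m) - f (real i * (1/2) ^ m) else 0)
      = f (real (nat \<lceil>T / (1/2) ^ m\<rceil>) * (1/2) ^ m) - f 0"
proof -
  have T: "ereal T = min hit (ereal K)"
    unfolding T_def using hit_nonneg by (cases hit) (auto simp: min_def)
  then have TK: "T \<le> K" by (metis ereal_less_eq(3) min.cobounded2)
  obtain \<delta> where \<delta>: "\<delta> > 0"
    "\<And>h j. 0 < h \<Longrightarrow> h \<le> \<delta> \<Longrightarrow> real j * h < K \<Longrightarrow> on h j \<longleftrightarrow> ereal (real j * h) < hit"
    using on_iff_before_hit[of K] by blast
  show ?thesis using eventually_half_power_le[OF \<delta>(1)]
  proof eventually_elim
    case (elim m)
    show ?case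
    proof (intro allI impI)
      fix k :: nat assume k: "real k * (1/2) ^ m = K"
      let ?h = "(1/2::real) ^ m"
      have "on ?h i \<longleftrightarrow> real i * ?h < T" if "i < k" for i
      proof -
        have iK: "real i * ?h < K" using that k by (auto simp flip: k)
        then have "on ?h i \<longleftrightarrow> ereal (real i * ?h) < hit" using elim by (intro \<delta>(2)) auto
        also have "\<dots> \<longleftrightarrow> ereal (real i * ?h) < ereal T" unfolding T using iK by simp
        finally show ?thesis by simp
      qed
      then have "(\<Sum>i<k. if on ?h i then f (real (Suc i) * ?h) - f (real i * ?h) else 0)
        = (\<Sum>i<k. if real i * ?h < T then f (real (Suc i) * ?h) - f (real i * ?h) else 0)"
        by (intro sum.cong) auto
      also have "\<dots> = f (real (nat \<lceil>T / ?h\<rceil>) * ?h) - f 0"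
        using TK k by (intro sum_stopped_increments) auto
      finally show "(\<Sum>i<k. if on ?h i then f (real (Suc i) * ?h) - f (real i * ?h) else 0)
        = f (real (nat \<lceil>T / ?h\<rceil>) * ?h) - f 0" .
    qed
  qed
qed

lemma stopped_time_bounds:
  assumes "0 \<le> K"
  shows "0 \<le> real_of_ereal (min hit (ereal K))" "real_of_ereal (min hit (ereal K)) \<le> K"
  using hit_nonneg assms by (cases hit; auto simp: min_def)+

lemma tendsto_sum_on:
  assumes "0 \<le> K" and k: "\<And>m. real (k m) * (1/2) ^ m = K"
  defines "T \<equiv> real_of_ereal (min hit (ereal K))"
  shows "(\<lambda>m. \<Sum>i<k m. if on ((1/2) ^ m) i then (1/2) ^ m else 0) \<longlonglongrightarrow> T"
    and "(\<lambda>m. \<Sum>i<k m. if on ((1/2) ^ m) i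
      then y (real (Suc i) * (1/2) ^ m) - y (real i * (1/2) ^ m) else 0) \<longlonglongrightarrow> y T - D"
proof -
  have T0: "0 \<le> T" using stopped_time_bounds[OF assms(1)] by (simp add: T_def)
  let ?g = "\<lambda>m. real (nat \<lceil>T / (1/2) ^ m\<rceil>) * (1/2) ^ m"
  have "\<forall>\<^sub>F m in sequentially. ?g m = (\<Sum>i<k m. if on ((1/2) ^ m) i then (1/2) ^ m else 0)"
    using eventually_sum_on[OF assms(1), of "\<lambda>s. s"]
  proof eventually_elim
    case (elim m)
    have "real (Suc i) * (1/2) ^ m - real i * (1/2) ^ m = (1/2::real) ^ m" for i
      by (simp add: algebra_simps)
    then show ?case using elim[rule_format, OF k[of m]] by (simp only: T_def)
  qed
  then show "(\<lambda>m. \<Sum>i<k m. if on ((1/2) ^ m) i then (1/2) ^ m else 0) \<longlonglongrightarrow> T"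
    using tendsto_dyadic_ceiling[OF T0] by (rule Lim_transform_eventually[rotated])
  have "\<forall>\<^sub>F m in sequentially. y T + T - ?g m - D = (\<Sum>i<k m. if on ((1/2) ^ m) i
      then y (real (Suc i) * (1/2) ^ m) - y (real i * (1/2) ^ m) else 0)"
    using eventually_sum_on[OF assms(1), of y] eventually_dyadic_ceiling_eq[OF T0 n_cont[OF T0]]
      eventually_dyadic_ceiling_eq[OF T0 c_cont[OF T0]]
  proof eventually_elim
    case (elim m)
    then show ?case using k[of m] by (simp add: T_def[symmetric]) (simp add: y_def n0 c0)
  qed
  moreover have "(\<lambda>m. y T + T - ?g m - D) \<longlonglongrightarrow> y T - D"
    using tendsto_diff[OF tendsto_diff[OF tendsto_const[of "y T + T"] tendsto_dyadic_ceiling[OF T0]] tendsto_const[of D]]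
    by simp
  ultimately show "(\<lambda>m. \<Sum>i<k m. if on ((1/2) ^ m) i
      then y (real (Suc i) * (1/2) ^ m) - y (real i * (1/2) ^ m) else 0) \<longlonglongrightarrow> y T - D"
    by (rule Lim_transform_eventually[rotated])
qed

lemma eventually_grid_interruption:
  assumes t: "0 \<le> t"
    and x: "D + real (n t) + real (c (real_of_ereal (min (ereal t) hit))) - t \<le> 0"
  shows "\<forall>\<^sub>F m in sequentially. \<exists>k. grid_buffer ((1/2) ^ m) k \<le> 0"
proof -
  obtain b1 where b1: "b1 > t" "\<And>s. t \<le> s \<Longrightarrow> s < b1 \<Longrightarrow> n s = n t"
    by (rule right_continuous_nat_const[OF n_cont[OF t]]) blast
  obtain b2 where b2: "b2 > t" "\<And>s. t \<le> s \<Longrightarrow> s < b2 \<Longrightarrow> c s = c t"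
    by (rule right_continuous_nat_const[OF c_cont[OF t]]) blast
  have "t < min b1 b2" using b1 b2 by simp
  from eventually_dyadic_ceiling[OF t this]
  obtain m0 where m0: "t \<le> real (nat \<lceil>t / (1/2) ^ m0\<rceil>) * (1/2) ^ m0"
    "real (nat \<lceil>t / (1/2) ^ m0\<rceil>) * (1/2) ^ m0 < min b1 b2"
    by (auto simp: eventually_sequentially)
  define k0 where "k0 = nat \<lceil>t / (1/2) ^ m0\<rceil>"
  define K where "K = real k0 * (1/2) ^ m0"
  define T where "T = real_of_ereal (min hit (ereal K))"
  have K: "t \<le> K" "K < b1" "K < b2" using m0 by (auto simp: K_def k0_def)
  have K0: "0 \<le> K" using K t by simp
  have T0: "0 \<le> T" using stopped_time_bounds[OF K0] by (simp add: T_def)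
  have "c T = c (real_of_ereal (min (ereal t) hit))"
  proof (cases "hit \<le> ereal t")
    case True
    then show ?thesis unfolding T_def using K
      by (metis dual_order.trans ereal_less_eq(3) min.absorb1 min.commute)
  next
    case False
    then have "min (ereal t) hit = ereal t" by simp
    moreover have "t \<le> T" "T \<le> K"
      unfolding T_def using False K hit_nonneg by (cases hit; auto simp: min_def)+
    ultimately show ?thesis using b2(2)[of T] K by simp
  qed
  then have x': "D + real (n K) + real (c T) - K \<le> 0" using x b1(2)[OF K(1,2)] K(1) by simp
  have "\<forall>\<^sub>F m in sequentially. m \<ge> m0" by (rule eventually_ge_at_top)
  then show ?thesis
    using eventually_sum_on[OF K0, of "\<lambda>s. real (c s)"] eventually_dyadic_ceiling_eq[OF T0 c_cont[OF T0]]
  proof eventually_elim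
    case (elim m)
    have k: "real (k0 * 2 ^ (m - m0)) * (1/2) ^ m = K"
    proof -
      have "(1/2::real) ^ m = (1/2) ^ (m - m0) * (1/2) ^ m0" using elim(1) by (simp flip: power_add)
      then show ?thesis by (simp add: K_def power_one_over)
    qed
    have "grid_buffer ((1/2) ^ m) (k0 * 2 ^ (m - m0)) = D + real (n K) + real (c T) - K"
      unfolding grid_buffer_def k using elim(2)[rule_format, OF k] elim(3)
      by (simp add: T_def[symmetric] c0)
    then show ?case using x' by (intro exI[of _ "k0 * 2 ^ (m - m0)"]) simp
  qed
qed

end

section \<open>Independence of discrete increments\<close>

primrec chain :: "(nat \<Rightarrow> 's \<Rightarrow> 'z \<Rightarrow> 's) \<Rightarrow> 's \<Rightarrow> (nat \<Rightarrow> 'z) \<Rightarrow> nat \<Rightarrow> 's" where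
  "chain step s z 0 = s"
| "chain step s z (Suc k) = step k (chain step s z k) (z k)"

lemma chain_cong: "(\<And>i. i < k \<Longrightarrow> z i = z' i) \<Longrightarrow> chain step s z k = chain step s z' k"
  by (induction k) auto

lemma measurable_countable2:
  fixes f :: "'a \<Rightarrow> 'b::countable" and g :: "'a \<Rightarrow> 'c::countable"
  assumes "f \<in> measurable M (count_space UNIV)" "g \<in> measurable M (count_space UNIV)"
  shows "(\<lambda>x. F (f x) (g x)) \<in> measurable M (count_space UNIV)"
proof -
  have "(\<lambda>x. (f x, g x)) \<in> measurable M (count_space UNIV)"
    using measurable_Pair[OF assms] by (simp add: pair_measure_countable)
  from measurable_compose[OF this, of "\<lambda>(x, y). F x y" "count_space UNIV"] show ?thesis by simp
qed

lemma measurable_chain: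
  fixes step :: "nat \<Rightarrow> 's::countable \<Rightarrow> 'z::countable \<Rightarrow> 's"
  shows "{..<k} \<subseteq> I \<Longrightarrow> (\<lambda>z. chain step s z k) \<in> measurable (Pi\<^sub>M I (\<lambda>_. count_space UNIV)) (count_space UNIV)"
proof (induction k)
  case (Suc k)
  have "(\<lambda>z. step k (chain step s z k) (z k)) \<in> measurable (Pi\<^sub>M I (\<lambda>_. count_space UNIV)) (count_space UNIV)"
  proof (rule measurable_countable2[where F="step k" and g="\<lambda>z. z k"])
    show "(\<lambda>z. chain step s z k) \<in> measurable (Pi\<^sub>M I (\<lambda>_. count_space UNIV)) (count_space UNIV)"
      using Suc by (intro Suc.IH) auto
    show "(\<lambda>z. z k) \<in> measurable (Pi\<^sub>M I (\<lambda>_. count_space UNIV)) (count_space UNIV)"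
      using Suc.prems by (intro measurable_component_singleton) auto
  qed
  then show ?case by simp
qed simp

context prob_space
begin

lemma nn_integral_indep_var_countable:
  fixes X Y :: "'a \<Rightarrow> 'b::countable"
  assumes ind: "indep_var (count_space UNIV) X (count_space UNIV) Y"
  shows "(\<integral>\<^sup>+\<omega>. F (X \<omega>) (Y \<omega>) \<partial>M) = (\<integral>\<^sup>+\<omega>. (\<integral>\<^sup>+\<omega>'. F (X \<omega>) (Y \<omega>') \<partial>M) \<partial>M)"
proof -
  have X[measurable]: "X \<in> measurable M (count_space UNIV)" and Y[measurable]: "Y \<in> measurable M (count_space UNIV)"
    using ind by (auto dest: indep_var_rv1 indep_var_rv2)
  interpret Y: prob_space "distr M (count_space UNIV) Y" by (rule prob_space_distr) measurable
  have sets: "sets (count_space (UNIV :: 'b set) \<Otimes>\<^sub>M count_space (UNIV :: 'b set)) = UNIV"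
    by (subst sets_pair_countable) auto
  have F: "(\<lambda>(s, z). F s z) \<in> borel_measurable (count_space UNIV \<Otimes>\<^sub>M count_space UNIV)"
    by (rule measurableI) (auto simp: sets)
  then have F': "(\<lambda>(s, z). F s z) \<in> borel_measurable (distr M (count_space UNIV) X \<Otimes>\<^sub>M distr M (count_space UNIV) Y)"
    by (subst measurable_cong_sets[OF sets_pair_measure_cong[OF sets_distr sets_distr] refl])
  have "(\<integral>\<^sup>+\<omega>. F (X \<omega>) (Y \<omega>) \<partial>M)
      = (\<integral>\<^sup>+p. (case p of (s, z) \<Rightarrow> F s z) \<partial>distr M (count_space UNIV \<Otimes>\<^sub>M count_space UNIV) (\<lambda>\<omega>. (X \<omega>, Y \<omega>)))"
    by (subst nn_integral_distr) (use F in auto)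
  also have "\<dots> = (\<integral>\<^sup>+p. (case p of (s, z) \<Rightarrow> F s z) \<partial>(distr M (count_space UNIV) X \<Otimes>\<^sub>M distr M (count_space UNIV) Y))"
    using ind by (simp add: indep_var_distribution_eq)
  also have "\<dots> = (\<integral>\<^sup>+s. (\<integral>\<^sup>+z. F s z \<partial>distr M (count_space UNIV) Y) \<partial>distr M (count_space UNIV) X)"
    by (subst Y.nn_integral_fst[symmetric, OF F']) simp
  also have "\<dots> = (\<integral>\<^sup>+\<omega>. (\<integral>\<^sup>+\<omega>'. F (X \<omega>) (Y \<omega>') \<partial>M) \<partial>M)"
    by (simp add: nn_integral_distr)
  finally show ?thesis .
qed

lemma indep_vars_Plus:
  fixes a :: "'i \<Rightarrow> 'a \<Rightarrow> 'b" and b :: "'i \<Rightarrow> 'a \<Rightarrow> 'b"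
  assumes I: "finite I" "I \<noteq> {}" and J: "finite J" "J \<noteq> {}"
    and a: "indep_vars (\<lambda>_. count_space UNIV) a I" and b: "indep_vars (\<lambda>_. count_space UNIV) b J"
    and ab: "indep_var (Pi\<^sub>M I (\<lambda>_. count_space UNIV)) (\<lambda>\<omega>. \<lambda>i\<in>I. a i \<omega>)
                       (Pi\<^sub>M J (\<lambda>_. count_space UNIV)) (\<lambda>\<omega>. \<lambda>j\<in>J. b j \<omega>)"
  shows "indep_vars (\<lambda>_. count_space UNIV) (case_sum a b) (I <+> J)"
proof (subst indep_vars_finite[where E="\<lambda>_. UNIV"])
  show "random_variable (count_space UNIV) (case_sum a b i)" if "i \<in> I <+> J" for i
    using that a b by (auto simp: indep_vars_def2)
  show "\<forall>A\<in>\<Pi> i\<in>I <+> J. UNIV. prob (\<Inter>j\<in>I <+> J. case_sum a b j -` A j \<inter> space M)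
      = (\<Prod>j\<in>I <+> J. prob (case_sum a b j -` A j \<inter> space M))"
  proof
    fix A :: "'i + 'i \<Rightarrow> 'b set"
    let ?A = "\<lambda>i. A (Inl i)" and ?B = "\<lambda>j. A (Inr j)"
    let ?ra = "\<lambda>\<omega>. \<lambda>i\<in>I. a i \<omega>" and ?rb = "\<lambda>\<omega>. \<lambda>j\<in>J. b j \<omega>"
    have "(\<Inter>j\<in>I <+> J. case_sum a b j -` A j \<inter> space M)
        = (\<lambda>\<omega>. (?ra \<omega>, ?rb \<omega>)) -` (PiE I ?A \<times> PiE J ?B) \<inter> space M"
      using I J unfolding Plus_def by (auto simp: PiE_iff ball_Un)
    then have "prob (\<Inter>j\<in>I <+> J. case_sum a b j -` A j \<inter> space M)
        = prob (?ra -` PiE I ?A \<inter> space M) * prob (?rb -` PiE J ?B \<inter> space M)"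
      using indep_varD[OF ab, of "PiE I ?A" "PiE J ?B"] I J by (simp add: sets_PiM_I_finite)
    also have "?ra -` PiE I ?A \<inter> space M = (\<Inter>i\<in>I. a i -` ?A i \<inter> space M)"
      using I by (auto simp: PiE_iff)
    also have "prob \<dots> = (\<Prod>i\<in>I. prob (a i -` ?A i \<inter> space M))"
      using I by (intro indep_varsD_finite[OF a]) auto
    also have "?rb -` PiE J ?B \<inter> space M = (\<Inter>i\<in>J. b i -` ?B i \<inter> space M)"
      using J by (auto simp: PiE_iff)
    also have "prob \<dots> = (\<Prod>i\<in>J. prob (b i -` ?B i \<inter> space M))"
      using J by (intro indep_varsD_finite[OF b]) auto
    finally show "prob (\<Inter>j\<in>I <+> J. case_sum a b j -` A j \<inter> space M)
      = (\<Prod>j\<in>I <+> J. prob (case_sum a b j -` A j \<inter> space M))"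
      using I J by (simp add: prod.Plus)
  qed
  show "sets (count_space UNIV) = sigma_sets (space (count_space UNIV)) (UNIV :: 'b set set)"
    by (auto intro: sigma_sets.Basic)
qed (use I J in \<open>auto simp: Int_stable_def\<close>)

lemma indep_vars_Pair:
  fixes a b :: "'i \<Rightarrow> 'a \<Rightarrow> 'b::countable"
  assumes I: "finite I" "I \<noteq> {}"
    and a: "indep_vars (\<lambda>_. count_space UNIV) a I" and b: "indep_vars (\<lambda>_. count_space UNIV) b I"
    and ab: "indep_var (Pi\<^sub>M I (\<lambda>_. count_space UNIV)) (\<lambda>\<omega>. \<lambda>i\<in>I. a i \<omega>)
                       (Pi\<^sub>M I (\<lambda>_. count_space UNIV)) (\<lambda>\<omega>. \<lambda>i\<in>I. b i \<omega>)"
  shows "indep_vars (\<lambda>_. count_space UNIV) (\<lambda>i \<omega>. (a i \<omega>, b i \<omega>)) I"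
proof -
  let ?X = "case_sum a b" and ?P = "\<lambda>i. Pi\<^sub>M {Inl i, Inr i :: 'i + 'i} (\<lambda>_. count_space (UNIV :: 'b set))"
  have "indep_vars ?P (\<lambda>i \<omega>. \<lambda>s\<in>{Inl i, Inr i}. ?X s \<omega>) I"
    by (rule indep_vars_restrict[OF indep_vars_Plus[OF I I a b ab]]) (auto simp: disjoint_family_on_def)
  then have "indep_vars (\<lambda>_. count_space UNIV)
      (\<lambda>i \<omega>. (\<lambda>f. (f (Inl i), f (Inr i))) (\<lambda>s\<in>{Inl i, Inr i}. ?X s \<omega>)) I"
  proof (rule indep_vars_compose2)
    fix i
    have "(\<lambda>f. (f (Inl i), f (Inr i))) \<in> measurable (?P i) (count_space UNIV \<Otimes>\<^sub>M count_space UNIV)"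
      by (intro measurable_Pair measurable_component_singleton) auto
    then show "(\<lambda>f. (f (Inl i), f (Inr i))) \<in> measurable (?P i) (count_space UNIV)"
      by (simp add: pair_measure_countable)
  qed
  then show ?thesis by simp
qed

lemma indep_var_chain:
  fixes step :: "nat \<Rightarrow> 's::countable \<Rightarrow> 'z::countable \<Rightarrow> 's" and s :: 's
  assumes ind: "indep_vars (\<lambda>_. count_space UNIV) Z {..<Suc k}"
  shows "indep_var (count_space UNIV) (\<lambda>\<omega>. to_nat (chain step s (\<lambda>i. Z i \<omega>) k))
      (count_space UNIV) (\<lambda>\<omega>. to_nat (Z k \<omega>))"
proof -
  let ?P = "\<lambda>I. Pi\<^sub>M I (\<lambda>_. count_space (UNIV :: 'z set))"
  have "indep_var (?P {..<k}) (\<lambda>\<omega>. \<lambda>i\<in>{..<k}. Z i \<omega>) (?P {k}) (\<lambda>\<omega>. \<lambda>i\<in>{k}. Z i \<omega>)"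
    by (rule indep_var_restrict[OF ind]) auto
  then have "indep_var (count_space UNIV) ((\<lambda>z. to_nat (chain step s z k)) \<circ> (\<lambda>\<omega>. \<lambda>i\<in>{..<k}. Z i \<omega>))
      (count_space UNIV) ((\<lambda>z. to_nat (z k)) \<circ> (\<lambda>\<omega>. \<lambda>i\<in>{k}. Z i \<omega>))"
  proof (rule indep_var_compose)
    show "(\<lambda>z. to_nat (chain step s z k)) \<in> measurable (?P {..<k}) (count_space UNIV)"
      by (rule measurable_compose[OF measurable_chain]) auto
    show "(\<lambda>z. to_nat (z k)) \<in> measurable (?P {k}) (count_space UNIV)"
      by (rule measurable_compose[OF measurable_component_singleton]) auto
  qed
  moreover have "chain step s (\<lambda>i\<in>{..<k}. Z i \<omega>) k = chain step s (\<lambda>i. Z i \<omega>) k" for \<omega>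
    by (rule chain_cong) simp
  ultimately show ?thesis by (simp add: comp_def)
qed

lemma nn_integral_chain:
  fixes step :: "nat \<Rightarrow> 's::countable \<Rightarrow> 'z::countable \<Rightarrow> 's" and s :: 's
  assumes ind: "indep_vars (\<lambda>_. count_space UNIV) Z {..<Suc k}"
  defines "X \<equiv> \<lambda>\<omega>. chain step s (\<lambda>i. Z i \<omega>) k"
  shows "(\<integral>\<^sup>+\<omega>. F (X \<omega>) (Z k \<omega>) \<partial>M) = (\<integral>\<^sup>+\<omega>. (\<integral>\<^sup>+\<omega>'. F (X \<omega>) (Z k \<omega>') \<partial>M) \<partial>M)"
  using nn_integral_indep_var_countable[OF indep_var_chain[OF ind, of step s], of "\<lambda>x z. F (from_nat x) (from_nat z)"]
  by (simp add: X_def)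

end

section \<open>The buffer of the safe policy\<close>

locale streaming = prob_space M for M :: "'a measure" +
  fixes N Nc :: "real \<Rightarrow> 'a \<Rightarrow> nat" and R0 Rc D :: real and S :: ereal
  assumes R0_pos: "R0 > 0" and Rc_pos: "Rc > 0"
    and N: "poisson_process M R0 N" and Nc: "poisson_process M Rc Nc"
    and indep: "independent_processes M N Nc"
begin

lemma path: "\<omega> \<in> space M \<Longrightarrow> buffer_path (\<lambda>t. N t \<omega>) (\<lambda>t. Nc t \<omega>)"
  using N Nc unfolding poisson_process_def by unfold_locales auto

definition Y :: "real \<Rightarrow> 'a \<Rightarrow> real" where
  "Y t \<omega> = D + real (N t \<omega>) + real (Nc t \<omega>) - t"

definition \<tau> :: "'a \<Rightarrow> ereal" where
  "\<tau> \<omega> = hitting_time S (\<lambda>t. Y t \<omega>)"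

definition grid_on :: "real \<Rightarrow> nat \<Rightarrow> 'a \<Rightarrow> bool" where
  "grid_on h j \<omega> \<longleftrightarrow> (\<forall>i\<le>j. ereal (Y (real i * h) \<omega> + h) < S)"

abbreviation G :: "real \<Rightarrow> nat \<Rightarrow> 'a \<Rightarrow> real" where
  "G h k \<omega> \<equiv> buffer_path.grid_buffer (\<lambda>t. N t \<omega>) (\<lambda>t. Nc t \<omega>) D S h k"

definition free_incr :: "real \<Rightarrow> nat \<Rightarrow> 'a \<Rightarrow> nat" where
  "free_incr h i \<omega> = N (real (Suc i) * h) \<omega> - N (real i * h) \<omega>"

definition costly_incr :: "real \<Rightarrow> nat \<Rightarrow> 'a \<Rightarrow> nat" where
  "costly_incr h i \<omega> = Nc (real (Suc i) * h) \<omega> - Nc (real i * h) \<omega>"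

lemma path_simps:
  assumes "\<omega> \<in> space M"
  shows "buffer_path.y (\<lambda>t. N t \<omega>) (\<lambda>t. Nc t \<omega>) D = (\<lambda>t. Y t \<omega>)"
    and "buffer_path.hit (\<lambda>t. N t \<omega>) (\<lambda>t. Nc t \<omega>) D S = \<tau> \<omega>"
    and "buffer_path.on (\<lambda>t. N t \<omega>) (\<lambda>t. Nc t \<omega>) D S = (\<lambda>h j. grid_on h j \<omega>)"
proof -
  interpret P: buffer_path "\<lambda>t. N t \<omega>" "\<lambda>t. Nc t \<omega>" D S by (rule path[OF assms])
  show y: "P.y = (\<lambda>t. Y t \<omega>)" by (simp add: fun_eq_iff P.y_def Y_def)
  show "P.hit = \<tau> \<omega>" by (simp add: P.hit_def \<tau>_def y)
  show "P.on = (\<lambda>h j. grid_on h j \<omega>)" by (simp add: fun_eq_iff P.on_def grid_on_def y)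
qed

lemma N_le: "\<omega> \<in> space M \<Longrightarrow> 0 \<le> s \<Longrightarrow> s \<le> t \<Longrightarrow> N s \<omega> \<le> N t \<omega>"
  using mono_onD[OF buffer_path.n_mono[OF path], of \<omega> s t] by simp

lemma Nc_le: "\<omega> \<in> space M \<Longrightarrow> 0 \<le> s \<Longrightarrow> s \<le> t \<Longrightarrow> Nc s \<omega> \<le> Nc t \<omega>"
  using mono_onD[OF buffer_path.c_mono[OF path], of \<omega> s t] by simp

lemma N_0: "\<omega> \<in> space M \<Longrightarrow> N 0 \<omega> = 0" and Nc_0: "\<omega> \<in> space M \<Longrightarrow> Nc 0 \<omega> = 0"
  using N Nc unfolding poisson_process_def by auto

lemma measurable_N [measurable]: "0 \<le> t \<Longrightarrow> N t \<in> measurable M (count_space UNIV)"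
  and measurable_Nc [measurable]: "0 \<le> t \<Longrightarrow> Nc t \<in> measurable M (count_space UNIV)"
  using N Nc unfolding poisson_process_def by auto

lemma real_increments:
  assumes "h > 0" "\<omega> \<in> space M"
  shows "real (free_incr h i \<omega>) = real (N (real (Suc i) * h) \<omega>) - real (N (real i * h) \<omega>)"
    and "real (costly_incr h i \<omega>) = real (Nc (real (Suc i) * h) \<omega>) - real (Nc (real i * h) \<omega>)"
  using N_le[OF assms(2), of "real i * h" "real (Suc i) * h"] Nc_le[OF assms(2), of "real i * h" "real (Suc i) * h"]
    assms(1) by (auto simp: free_incr_def costly_incr_def of_nat_diff mult_right_mono)

lemma distr_increments:
  assumes "h > 0"
  shows "distr M (count_space UNIV) (free_incr h i) = measure_pmf (poisson_pmf (R0 * h))"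
    and "distr M (count_space UNIV) (costly_incr h i) = measure_pmf (poisson_pmf (Rc * h))"
proof -
  have h: "0 \<le> real i * h" "real i * h < real (Suc i) * h" "real (Suc i) * h - real i * h = h"
    using assms by (auto simp: algebra_simps)
  have "distr M (count_space UNIV) (free_incr h i) = measure_pmf (poisson_pmf (R0 * (real (Suc i) * h - real i * h)))"
    using N h(1,2) unfolding poisson_process_def free_incr_def[abs_def] by blast
  then show "distr M (count_space UNIV) (free_incr h i) = measure_pmf (poisson_pmf (R0 * h))" by (simp only: h(3))
  have "distr M (count_space UNIV) (costly_incr h i) = measure_pmf (poisson_pmf (Rc * (real (Suc i) * h - real i * h)))"
    using Nc h(1,2) unfolding poisson_process_def costly_incr_def[abs_def] by blast
  then show "distr M (count_space UNIV) (costly_incr h i) = measure_pmf (poisson_pmf (Rc * h))" by (simp only: h(3))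
qed

lemma indep_increments_of_processes:
  assumes "h > 0"
  shows "indep_var (Pi\<^sub>M I (\<lambda>_. count_space UNIV)) (\<lambda>\<omega>. \<lambda>i\<in>I. free_incr h i \<omega>)
                   (Pi\<^sub>M I (\<lambda>_. count_space UNIV)) (\<lambda>\<omega>. \<lambda>i\<in>I. costly_incr h i \<omega>)"
proof -
  let ?f = "\<lambda>p. \<lambda>i\<in>I. p (real (Suc i) * h) - p (real i * h) :: nat"
  have "?f \<in> measurable (Pi\<^sub>M {0..} (\<lambda>_. count_space UNIV)) (Pi\<^sub>M I (\<lambda>_. count_space UNIV))"
  proof (rule measurable_restrict)
    fix i
    show "(\<lambda>p. p (real (Suc i) * h) - p (real i * h) :: nat)
        \<in> measurable (Pi\<^sub>M {0..} (\<lambda>_. count_space UNIV)) (count_space UNIV)"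
      by (rule measurable_countable2[where F="(-)" and f="\<lambda>p. p (real (Suc i) * h)" and g="\<lambda>p. p (real i * h)"])
        (use assms in \<open>auto intro!: measurable_component_singleton\<close>)
  qed
  from indep_var_compose[OF indep[unfolded independent_processes_def] this this]
  have "indep_var (Pi\<^sub>M I (\<lambda>_. count_space UNIV)) (\<lambda>\<omega>. ?f (\<lambda>t\<in>{0..}. N t \<omega>))
                   (Pi\<^sub>M I (\<lambda>_. count_space UNIV)) (\<lambda>\<omega>. ?f (\<lambda>t\<in>{0..}. Nc t \<omega>))"
    by (simp add: comp_def)
  moreover have "?f (\<lambda>t\<in>{0..}. N t \<omega>) = (\<lambda>i\<in>I. free_incr h i \<omega>)" for \<omega>
    using assms by (auto simp: free_incr_def fun_eq_iff)
  moreover have "?f (\<lambda>t\<in>{0..}. Nc t \<omega>) = (\<lambda>i\<in>I. costly_incr h i \<omega>)" for \<omega>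
    using assms by (auto simp: costly_incr_def fun_eq_iff)
  ultimately show ?thesis by simp
qed

lemma indep_increment:
  assumes "h > 0"
  shows "indep_var (count_space UNIV) (free_incr h i) (count_space UNIV) (costly_incr h i)"
proof -
  have "(\<lambda>f. f i) \<in> measurable (Pi\<^sub>M {i} (\<lambda>_. count_space UNIV)) (count_space (UNIV :: nat set))"
    by (rule measurable_component_singleton) simp
  from indep_var_compose[OF indep_increments_of_processes[OF assms, of "{i}"] this this]
  show ?thesis by (simp add: comp_def)
qed

lemma measurable_increments [measurable]:
  assumes "h > 0"
  shows "free_incr h i \<in> measurable M (count_space UNIV)" "costly_incr h i \<in> measurable M (count_space UNIV)"
  using indep_increment[OF assms, of i] by (auto dest: indep_var_rv1 indep_var_rv2)

lemma indep_grid_increments: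
  assumes "h > 0"
  shows "indep_vars (\<lambda>_. count_space UNIV) (\<lambda>i \<omega>. (free_incr h i \<omega>, costly_incr h i \<omega>)) {..<Suc k}"
proof (rule indep_vars_Pair[OF _ _ _ _ indep_increments_of_processes[OF assms]])
  have t: "0 \<le> real 0 * h" "mono (\<lambda>i. real i * h)"
    using assms by (auto intro!: monoI mult_right_mono)
  have incr: "indep_vars (\<lambda>_. count_space UNIV) (\<lambda>i \<omega>. P (t (Suc i)) \<omega> - P (t i) \<omega>) {..<k}"
    if "poisson_process M R P" "0 \<le> t 0" "mono t" for R P k t
    using that unfolding poisson_process_def by simp
  show "indep_vars (\<lambda>_. count_space UNIV) (free_incr h) {..<Suc k}"
    using incr[OF N t] by (simp only: free_incr_def[abs_def])
  show "indep_vars (\<lambda>_. count_space UNIV) (costly_incr h) {..<Suc k}"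
    using incr[OF Nc t] by (simp only: costly_incr_def[abs_def])
qed auto

lemma nn_integral_increments:
  assumes "h > 0"
  shows "(\<integral>\<^sup>+\<omega>. f (free_incr h i \<omega>) \<partial>M) = (\<integral>\<^sup>+n. f n \<partial>measure_pmf (poisson_pmf (R0 * h)))"
    and "(\<integral>\<^sup>+\<omega>. f (costly_incr h i \<omega>) \<partial>M) = (\<integral>\<^sup>+n. f n \<partial>measure_pmf (poisson_pmf (Rc * h)))"
  unfolding distr_increments[OF assms, of i, symmetric]
  by (simp_all add: nn_integral_distr measurable_increments[OF assms])

lemma nn_integral_exp_increments:
  fixes h r z :: real
  assumes h: "h > 0"
  shows "r + R0 * (exp (- r) - 1) = 0 \<Longrightarrow> (\<integral>\<^sup>+\<omega>. ennreal (exp (- r * (z + free_incr h i \<omega> - h))) \<partial>M) = ennreal (exp (- r * z))"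
    and "r + (R0 + Rc) * (exp (- r) - 1) = 0 \<Longrightarrow>
      (\<integral>\<^sup>+\<omega>. ennreal (exp (- r * (z + free_incr h i \<omega> + costly_incr h i \<omega> - h))) \<partial>M) = ennreal (exp (- r * z))"
proof -
  note [measurable] = measurable_increments[OF h]
  have A: "(\<integral>\<^sup>+\<omega>. ennreal (exp (- r * real (free_incr h i \<omega>))) \<partial>M) = ennreal (exp (R0 * h * (exp (- r) - 1)))"
    unfolding nn_integral_increments[OF h, of "\<lambda>n. ennreal (exp (- r * real n))"]
    using h R0_pos by (subst nn_integral_poisson_exp) auto
  have B: "(\<integral>\<^sup>+\<omega>. ennreal (exp (- r * real (costly_incr h i \<omega>))) \<partial>M) = ennreal (exp (Rc * h * (exp (- r) - 1)))"
    unfolding nn_integral_increments[OF h, of "\<lambda>n. ennreal (exp (- r * real n))"]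
    using h Rc_pos by (subst nn_integral_poisson_exp) auto
  {
    assume root: "r + R0 * (exp (- r) - 1) = 0"
    have "(\<integral>\<^sup>+\<omega>. ennreal (exp (- r * (z + free_incr h i \<omega> - h))) \<partial>M)
      = (\<integral>\<^sup>+\<omega>. ennreal (exp (- r * (z - h))) * ennreal (exp (- r * real (free_incr h i \<omega>))) \<partial>M)"
      by (simp add: ennreal_mult[symmetric] exp_add[symmetric] algebra_simps)
    also have "\<dots> = ennreal (exp (- r * (z - h))) * ennreal (exp (R0 * h * (exp (- r) - 1)))"
      by (subst nn_integral_cmult) (simp_all add: A[simplified])
    also have "\<dots> = ennreal (exp (- r * z + h * (r + R0 * (exp (- r) - 1))))"
      by (simp add: ennreal_mult[symmetric] exp_add[symmetric] algebra_simps)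
    finally show "(\<integral>\<^sup>+\<omega>. ennreal (exp (- r * (z + free_incr h i \<omega> - h))) \<partial>M) = ennreal (exp (- r * z))"
      unfolding root by simp
  }
  assume root: "r + (R0 + Rc) * (exp (- r) - 1) = 0"
  have "(\<integral>\<^sup>+\<omega>. ennreal (exp (- r * (z + free_incr h i \<omega> + costly_incr h i \<omega> - h))) \<partial>M)
    = (\<integral>\<^sup>+\<omega>. ennreal (exp (- r * (z - h))) * (ennreal (exp (- r * real (free_incr h i \<omega>))) * ennreal (exp (- r * real (costly_incr h i \<omega>)))) \<partial>M)"
    by (simp add: ennreal_mult[symmetric] exp_add[symmetric] algebra_simps)
  also have "\<dots> = ennreal (exp (- r * (z - h))) *
      (\<integral>\<^sup>+\<omega>. ennreal (exp (- r * real (free_incr h i \<omega>))) * ennreal (exp (- r * real (costly_incr h i \<omega>))) \<partial>M)"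
    by (rule nn_integral_cmult) measurable
  also have "(\<integral>\<^sup>+\<omega>. ennreal (exp (- r * real (free_incr h i \<omega>))) * ennreal (exp (- r * real (costly_incr h i \<omega>))) \<partial>M)
    = (\<integral>\<^sup>+\<omega>. ennreal (exp (- r * real (free_incr h i \<omega>))) * ennreal (exp (Rc * h * (exp (- r) - 1))) \<partial>M)"
    by (subst nn_integral_indep_var_countable[OF indep_increment[OF h],
        where F="\<lambda>m n. ennreal (exp (- r * real m)) * ennreal (exp (- r * real n))"])
      (simp add: nn_integral_cmult B[simplified])
  also have "\<dots> = ennreal (exp (R0 * h * (exp (- r) - 1))) * ennreal (exp (Rc * h * (exp (- r) - 1)))"
    by (subst nn_integral_multc) (simp_all add: A[simplified])
  also have "ennreal (exp (- r * (z - h))) * \<dots> = ennreal (exp (- r * z + h * (r + (R0 + Rc) * (exp (- r) - 1))))"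
    by (simp add: ennreal_mult[symmetric] exp_add[symmetric] algebra_simps)
  finally show "(\<integral>\<^sup>+\<omega>. ennreal (exp (- r * (z + free_incr h i \<omega> + costly_incr h i \<omega> - h))) \<partial>M) = ennreal (exp (- r * z))"
    unfolding root by simp
qed

text \<open>The state of the chain: arrivals of the free server, accepted arrivals of the costly server,
  whether the costly server is still on, and whether the grid buffer has already been empty.\<close>

definition move :: "real \<Rightarrow> nat \<Rightarrow> nat \<times> nat \<times> bool \<times> bool \<Rightarrow> nat \<times> nat \<Rightarrow> nat \<times> nat \<times> bool \<times> bool" where
  "move h k = (\<lambda>(n, c, p, d) (u, v).
     let n' = n + u; c' = (if p then c + v else c); x = D + real n' + real c' - real (Suc k) * h
     in (n', c', p \<and> ereal (x + h) < S, d \<or> x \<le> 0))"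

definition state :: "real \<Rightarrow> nat \<Rightarrow> 'a \<Rightarrow> nat \<times> nat \<times> bool \<times> bool" where
  "state h k \<omega> = chain (move h) (0, 0, ereal (D + h) < S, D \<le> 0) (\<lambda>i. (free_incr h i \<omega>, costly_incr h i \<omega>)) k"

lemma measurable_state [measurable]:
  assumes "h > 0"
  shows "state h k \<in> measurable M (count_space UNIV)"
proof -
  have "(\<lambda>\<omega>. to_nat (state h k \<omega>)) \<in> measurable M (count_space UNIV)"
    using indep_var_rv1[OF indep_var_chain[OF indep_grid_increments[OF assms]]]
    by (simp add: state_def[abs_def])
  from measurable_compose[OF this, of "from_nat :: nat \<Rightarrow> nat \<times> nat \<times> bool \<times> bool" "count_space UNIV"] show ?thesis by simp
qed

lemma state_eq:
  assumes h: "h > 0" and \<omega>: "\<omega> \<in> space M"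
  shows "\<exists>c. state h k \<omega> = (N (real k * h) \<omega>, c, grid_on h k \<omega>, \<exists>j\<le>k. G h j \<omega> \<le> 0)
    \<and> G h k \<omega> = D + real (N (real k * h) \<omega>) + real c - real k * h
    \<and> (grid_on h k \<omega> \<longrightarrow> c = Nc (real k * h) \<omega>)"
proof -
  interpret P: buffer_path "\<lambda>t. N t \<omega>" "\<lambda>t. Nc t \<omega>" D S by (rule path[OF \<omega>])
  note on = path_simps(3)[OF \<omega>]
  show ?thesis
  proof (induction k)
    case 0
    show ?case
      by (rule exI[of _ 0]) (simp add: state_def grid_on_def Y_def N_0[OF \<omega>] Nc_0[OF \<omega>] P.grid_buffer_def)
  next
    case (Suc k)
    then obtain c where c: "state h k \<omega> = (N (real k * h) \<omega>, c, grid_on h k \<omega>, \<exists>j\<le>k. G h j \<omega> \<le> 0)"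
      "G h k \<omega> = D + real (N (real k * h) \<omega>) + real c - real k * h"
      "grid_on h k \<omega> \<Longrightarrow> c = Nc (real k * h) \<omega>" by blast
    define c' where "c' = (if grid_on h k \<omega> then c + costly_incr h k \<omega> else c)"
    note inc = real_increments[OF h \<omega>, of k]
    have n': "N (real k * h) \<omega> + free_incr h k \<omega> = N (real (Suc k) * h) \<omega>" using inc(1) by linarith
    have c'N: "c' = Nc (real (Suc k) * h) \<omega>" if "grid_on h k \<omega>"
      using inc(2) c(3)[OF that] that by (simp add: c'_def del: of_nat_Suc)
    have G': "G h (Suc k) \<omega> = D + real (N (real (Suc k) * h) \<omega>) + real c' - real (Suc k) * h"
      using c(2) inc(2) unfolding P.grid_buffer_def on c'_def by (simp del: of_nat_Suc)
    have on': "grid_on h (Suc k) \<omega> \<longleftrightarrow> grid_on h k \<omega> \<and> ereal (G h (Suc k) \<omega> + h) < S"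
    proof (cases "grid_on h k \<omega>")
      case True
      then show ?thesis unfolding G' c'N[OF True] by (auto simp: grid_on_def le_Suc_eq Y_def)
    qed (auto simp: grid_on_def)
    have "state h (Suc k) \<omega> = (N (real (Suc k) * h) \<omega>, c', grid_on h (Suc k) \<omega>, \<exists>j\<le>Suc k. G h j \<omega> \<le> 0)"
    proof -
      have "state h (Suc k) \<omega> = move h k (state h k \<omega>) (free_incr h k \<omega>, costly_incr h k \<omega>)" by (simp add: state_def)
      also have "\<dots> = (N (real (Suc k) * h) \<omega>, c', grid_on h k \<omega> \<and> ereal (G h (Suc k) \<omega> + h) < S,
          (\<exists>j\<le>k. G h j \<omega> \<le> 0) \<or> G h (Suc k) \<omega> \<le> 0)"
        unfolding c(1) move_def G' Let_def prod.case n' c'_def by simp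
      finally show ?thesis unfolding on' by (auto simp: le_Suc_eq)
    qed
    then show ?case using G' c'N on' by blast
  qed
qed

definition potential :: "real \<Rightarrow> real \<Rightarrow> real \<Rightarrow> real \<Rightarrow> nat \<Rightarrow> nat \<times> nat \<times> bool \<times> bool \<Rightarrow> real" where
  "potential r0 r1 q h k = (\<lambda>(n, c, p, d). let x = D + real n + real c - real k * h in
     if d then 1 else if p then exp (- r1 * x) + q else exp (- r0 * x))"

context
  fixes r0 r1 q h :: real
  assumes r0: "r0 > 0" "r0 + R0 * (exp (- r0) - 1) = 0"
    and r1: "r1 > 0" "r1 + (R0 + Rc) * (exp (- r1) - 1) = 0"
    and q: "q \<ge> 0" "\<And>x. S \<le> ereal (x + h) \<Longrightarrow> exp (- r0 * x) \<le> q"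
    and h: "h > 0"
begin

lemma potential_step:
  "(\<integral>\<^sup>+\<omega>. ennreal (potential r0 r1 q h (Suc k) (move h k s (free_incr h k \<omega>, costly_incr h k \<omega>))) \<partial>M)
    \<le> ennreal (potential r0 r1 q h k s)"
proof -
  note [measurable] = measurable_increments[OF h]
  obtain n c p d where s: "s = (n, c, p, d)" by (cases s) auto
  define x where "x = D + real n + real c - real k * h"
  consider "d" | "\<not> d" "p" | "\<not> d" "\<not> p" by blast
  then show ?thesis
  proof cases
    case 1
    then show ?thesis by (simp add: s potential_def move_def Let_def emeasure_space_1)
  next
    case 2
    have le: "potential r0 r1 q h (Suc k) (move h k s (free_incr h k \<omega>, costly_incr h k \<omega>))
        \<le> exp (- r1 * (x + free_incr h k \<omega> + costly_incr h k \<omega> - h)) + q" for \<omega>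
    proof -
      define z where "z = x + free_incr h k \<omega> + costly_incr h k \<omega> - h"
      have z: "D + real (n + free_incr h k \<omega>) + real (c + costly_incr h k \<omega>) - real (Suc k) * h = z"
        by (simp add: z_def x_def algebra_simps)
      have "potential r0 r1 q h (Suc k) (move h k s (free_incr h k \<omega>, costly_incr h k \<omega>)) =
          (if z \<le> 0 then 1 else if ereal (z + h) < S then exp (- r1 * z) + q else exp (- r0 * z))"
        unfolding potential_def move_def s Let_def prod.case using 2 z by (simp del: of_nat_Suc of_nat_add)
      also have "\<dots> \<le> exp (- r1 * z) + q"
        using q(1) q(2)[of z] r1(1) by (auto simp: not_less mult_nonneg_nonpos add_increasing2 add_increasing)
      finally show ?thesis by (simp only: z_def)
    qed
    have "(\<integral>\<^sup>+\<omega>. ennreal (potential r0 r1 q h (Suc k) (move h k s (free_incr h k \<omega>, costly_incr h k \<omega>))) \<partial>M)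
        \<le> (\<integral>\<^sup>+\<omega>. ennreal (exp (- r1 * (x + free_incr h k \<omega> + costly_incr h k \<omega> - h))) + ennreal q \<partial>M)"
      using le q(1) by (intro nn_integral_mono) (simp add: ennreal_plus[symmetric] ennreal_leI del: ennreal_plus)
    also have "\<dots> = ennreal (exp (- r1 * x)) + ennreal q"
      using nn_integral_exp_increments(2)[OF h r1(2), of x k]
      by (subst nn_integral_add) (simp_all add: emeasure_space_1)
    also have "\<dots> = ennreal (potential r0 r1 q h k s)"
      using 2 q(1) by (simp add: s potential_def x_def)
    finally show ?thesis .
  next
    case 3
    have le: "potential r0 r1 q h (Suc k) (move h k s (free_incr h k \<omega>, costly_incr h k \<omega>))
        \<le> exp (- r0 * (x + free_incr h k \<omega> - h))" for \<omega>
    proof -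
      define z where "z = x + free_incr h k \<omega> - h"
      have z: "D + real (n + free_incr h k \<omega>) + real c - real (Suc k) * h = z"
        by (simp add: z_def x_def algebra_simps)
      have "potential r0 r1 q h (Suc k) (move h k s (free_incr h k \<omega>, costly_incr h k \<omega>)) =
          (if z \<le> 0 then 1 else exp (- r0 * z))"
        unfolding potential_def move_def s Let_def prod.case using 3 z by (simp del: of_nat_Suc of_nat_add)
      also have "\<dots> \<le> exp (- r0 * z)" using r0(1) by (auto simp: mult_nonneg_nonpos)
      finally show ?thesis by (simp only: z_def)
    qed
    have "(\<integral>\<^sup>+\<omega>. ennreal (potential r0 r1 q h (Suc k) (move h k s (free_incr h k \<omega>, costly_incr h k \<omega>))) \<partial>M)
        \<le> (\<integral>\<^sup>+\<omega>. ennreal (exp (- r0 * (x + free_incr h k \<omega> - h))) \<partial>M)"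
      using le by (intro nn_integral_mono ennreal_leI)
    also have "\<dots> = ennreal (exp (- r0 * x))" by (rule nn_integral_exp_increments(1)[OF h r0(2)])
    also have "\<dots> = ennreal (potential r0 r1 q h k s)"
      using 3 by (simp add: s potential_def x_def)
    finally show ?thesis .
  qed
qed

lemma nn_integral_potential:
  "(\<integral>\<^sup>+\<omega>. ennreal (potential r0 r1 q h k (state h k \<omega>)) \<partial>M)
     \<le> ennreal (potential r0 r1 q h 0 (0, 0, ereal (D + h) < S, D \<le> 0))"
proof (induction k)
  case 0
  show ?case by (simp add: state_def emeasure_space_1)
next
  case (Suc k)
  have "(\<integral>\<^sup>+\<omega>. ennreal (potential r0 r1 q h (Suc k) (state h (Suc k) \<omega>)) \<partial>M)
    = (\<integral>\<^sup>+\<omega>. ennreal (potential r0 r1 q h (Suc k) (move h k (state h k \<omega>) (free_incr h k \<omega>, costly_incr h k \<omega>))) \<partial>M)"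
    by (simp add: state_def)
  also have "\<dots> = (\<integral>\<^sup>+\<omega>. (\<integral>\<^sup>+\<omega>'. ennreal (potential r0 r1 q h (Suc k) (move h k (state h k \<omega>) (free_incr h k \<omega>', costly_incr h k \<omega>'))) \<partial>M) \<partial>M)"
    unfolding state_def
    by (rule nn_integral_chain[OF indep_grid_increments[OF h],
        where F="\<lambda>s z. ennreal (potential r0 r1 q h (Suc k) (move h k s z))"])
  also have "\<dots> \<le> (\<integral>\<^sup>+\<omega>. ennreal (potential r0 r1 q h k (state h k \<omega>)) \<partial>M)"
    by (intro nn_integral_mono potential_step)
  also note Suc
  finally show ?case .
qed

lemma grid_dead_sets: "{\<omega> \<in> space M. \<exists>j\<le>k. G h j \<omega> \<le> 0} \<in> sets M"
proof -
  have "{\<omega> \<in> space M. \<exists>j\<le>k. G h j \<omega> \<le> 0} = {\<omega> \<in> space M. snd (snd (snd (state h k \<omega>)))}"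
    using state_eq[OF h, of _ k] by force
  also have "\<dots> = state h k -` {s. snd (snd (snd s))} \<inter> space M" by auto
  also have "\<dots> \<in> sets M" by (rule measurable_sets[OF measurable_state[OF h]]) simp
  finally show ?thesis .
qed

lemma prob_grid_dead:
  assumes "D > 0"
  shows "prob {\<omega> \<in> space M. \<exists>k. G h k \<omega> \<le> 0} \<le> exp (- r1 * D) + q"
    and "{\<omega> \<in> space M. \<exists>k. G h k \<omega> \<le> 0} \<in> sets M"
proof -
  let ?B = "\<lambda>k. {\<omega> \<in> space M. \<exists>j\<le>k. G h j \<omega> \<le> 0}"
  have Un: "(\<Union>k. ?B k) = {\<omega> \<in> space M. \<exists>k. G h k \<omega> \<le> 0}" by auto
  have "(\<Union>k. ?B k) \<in> sets M" by (intro sets.countable_UN image_subsetI grid_dead_sets)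
  then show "{\<omega> \<in> space M. \<exists>k. G h k \<omega> \<le> 0} \<in> sets M" by (simp only: Un)
  have "potential r0 r1 q h 0 (0, 0, ereal (D + h) < S, D \<le> 0) \<le> exp (- r1 * D) + q"
    using assms q(1) q(2)[of D] by (auto simp: potential_def not_less add_increasing)
  moreover have "emeasure M (?B k) \<le> (\<integral>\<^sup>+\<omega>. ennreal (potential r0 r1 q h k (state h k \<omega>)) \<partial>M)" for k
  proof -
    have "emeasure M (?B k) = (\<integral>\<^sup>+\<omega>. indicator (?B k) \<omega> \<partial>M)"
      by (rule nn_integral_indicator[OF grid_dead_sets, symmetric])
    also have "\<dots> \<le> (\<integral>\<^sup>+\<omega>. ennreal (potential r0 r1 q h k (state h k \<omega>)) \<partial>M)"
    proof (rule nn_integral_mono)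
      fix \<omega> assume \<omega>: "\<omega> \<in> space M"
      then obtain c where "state h k \<omega> = (N (real k * h) \<omega>, c, grid_on h k \<omega>, \<exists>j\<le>k. G h j \<omega> \<le> 0)"
        using state_eq[OF h \<omega>] by blast
      then show "indicator (?B k) \<omega> \<le> ennreal (potential r0 r1 q h k (state h k \<omega>))"
        by (simp add: potential_def indicator_def)
    qed
    finally show ?thesis .
  qed
  ultimately have "emeasure M (?B k) \<le> ennreal (exp (- r1 * D) + q)" for k
    using nn_integral_potential[of k] by (meson ennreal_leI order_trans)
  then have le: "prob (?B k) \<le> exp (- r1 * D) + q" for k
    using q(1) by (simp add: emeasure_eq_measure ennreal_le_iff add_nonneg_nonneg del: ennreal_plus)
  have "(\<lambda>k. prob (?B k)) \<longlonglongrightarrow> prob (\<Union>k. ?B k)"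
  proof (rule finite_Lim_measure_incseq)
    show "range ?B \<subseteq> sets M" by (intro image_subsetI grid_dead_sets)
    show "incseq ?B" unfolding incseq_def by (blast intro: le_trans)
  qed
  then show "prob {\<omega> \<in> space M. \<exists>k. G h k \<omega> \<le> 0} \<le> exp (- r1 * D) + q"
    unfolding Un using le by (intro LIMSEQ_le_const2) auto
qed

end

lemma closed_loop_trajectory:
  assumes "\<omega> \<in> space M" "0 \<le> t"
  shows "action N Nc D (safe_policy S) t \<omega> = (if ereal t \<le> \<tau> \<omega> then 1 else 0)"
    and "buffer N Nc D (safe_policy S) t \<omega>
      = D + real (N t \<omega>) + real (Nc (real_of_ereal (min (ereal t) (\<tau> \<omega>))) \<omega>) - t"
proof -
  interpret P: buffer_path "\<lambda>t. N t \<omega>" "\<lambda>t. Nc t \<omega>" D S by (rule path[OF assms(1)])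
  let ?p = "trajectory D (\<lambda>s. N s \<omega>) (\<lambda>s. Nc s \<omega>) (safe_policy S)"
  have "\<exists>x u. closed_loop D (\<lambda>s. N s \<omega>) (\<lambda>s. Nc s \<omega>) (safe_policy S) x u"
    by (rule ex_closed_loop_safe_policy) (use P.n_cont P.c0 P.c_mono P.c_cont in auto)
  then have "\<exists>p. closed_loop D (\<lambda>s. N s \<omega>) (\<lambda>s. Nc s \<omega>) (safe_policy S) (fst p) (snd p)" by simp
  then have cl: "closed_loop D (\<lambda>s. N s \<omega>) (\<lambda>s. Nc s \<omega>) (safe_policy S) (fst ?p) (snd ?p)"
    unfolding trajectory_def by (rule someI_ex)
  have \<tau>: "\<tau> \<omega> = hitting_time S (\<lambda>t. D + real (N t \<omega>) + real (Nc t \<omega>) - t)"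
    by (simp add: \<tau>_def Y_def)
  show "action N Nc D (safe_policy S) t \<omega> = (if ereal t \<le> \<tau> \<omega> then 1 else 0)"
    unfolding action_def \<tau>
    by (rule closed_loop_safe_policy(1)[OF _ _ _ _ cl assms(2)]) (use P.n_cont P.c0 P.c_mono P.c_cont in auto)
  show "buffer N Nc D (safe_policy S) t \<omega>
      = D + real (N t \<omega>) + real (Nc (real_of_ereal (min (ereal t) (\<tau> \<omega>))) \<omega>) - t"
    unfolding buffer_def \<tau>
    by (rule closed_loop_safe_policy(2)[OF _ _ _ _ cl assms(2)]) (use P.n_cont P.c0 P.c_mono P.c_cont in auto)
qed

lemma interruption_prob_le:
  assumes r0: "r0 > 0" "r0 + R0 * (exp (- r0) - 1) = 0"
    and r1: "r1 > 0" "r1 + (R0 + Rc) * (exp (- r1) - 1) = 0"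
    and D: "D > 0"
    and q: "\<And>m. q m \<ge> 0" "\<And>m x. S \<le> ereal (x + (1/2) ^ m) \<Longrightarrow> exp (- r0 * x) \<le> q m"
    and lim: "q \<longlonglongrightarrow> L"
  shows "interruption_prob M N Nc D (safe_policy S) \<le> exp (- r1 * D) + L"
proof -
  let ?E = "\<lambda>m. {\<omega> \<in> space M. \<exists>k. G ((1/2) ^ m) k \<omega> \<le> 0}"
  have E: "prob (?E m) \<le> exp (- r1 * D) + q m" "?E m \<in> sets M" for m
    using prob_grid_dead[where h="(1/2) ^ m" and q="q m", OF r0 r1 q(1) q(2) _ D] by auto
  define F where "F m = (\<Inter>i\<in>{m..}. ?E i)" for m
  have F: "F m \<in> sets M" for m unfolding F_def by (intro sets.countable_INT' image_subsetI E(2)) auto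
  have "prob (F m) \<le> exp (- r1 * D) + L" for m
  proof (rule LIMSEQ_le_const)
    show "(\<lambda>m. exp (- r1 * D) + q m) \<longlonglongrightarrow> exp (- r1 * D) + L"
      by (intro tendsto_intros lim)
    have "prob (F m) \<le> exp (- r1 * D) + q i" if "m \<le> i" for i
    proof -
      have "prob (F m) \<le> prob (?E i)" unfolding F_def
        by (rule finite_measure_mono[OF _ E(2)]) (use that in blast)
      then show ?thesis using E(1)[of i] by simp
    qed
    then show "\<exists>N. \<forall>n\<ge>N. prob (F m) \<le> exp (- r1 * D) + q n" by blast
  qed
  moreover have "(\<lambda>m. prob (F m)) \<longlonglongrightarrow> prob (\<Union>m. F m)"
  proof (rule finite_Lim_measure_incseq)
    show "range F \<subseteq> sets M" using F by auto
    show "incseq F" unfolding incseq_def F_def by fastforce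
  qed
  ultimately have le: "prob (\<Union>m. F m) \<le> exp (- r1 * D) + L"
    by (intro LIMSEQ_le_const2) auto
  have "{\<omega> \<in> space M. \<exists>t\<ge>0. buffer N Nc D (safe_policy S) t \<omega> \<le> 0} \<subseteq> (\<Union>m. F m)"
  proof
    fix \<omega> assume "\<omega> \<in> {\<omega> \<in> space M. \<exists>t\<ge>0. buffer N Nc D (safe_policy S) t \<omega> \<le> 0}"
    then obtain t where \<omega>: "\<omega> \<in> space M" and t: "0 \<le> t" "buffer N Nc D (safe_policy S) t \<omega> \<le> 0" by blast
    interpret P: buffer_path "\<lambda>t. N t \<omega>" "\<lambda>t. Nc t \<omega>" D S by (rule path[OF \<omega>])
    have "\<forall>\<^sub>F m in sequentially. \<exists>k. G ((1/2) ^ m) k \<omega> \<le> 0"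
      using t closed_loop_trajectory(2)[OF \<omega> t(1)]
      by (intro P.eventually_grid_interruption[OF t(1)]) (simp add: path_simps(2)[OF \<omega>])
    then obtain m where "\<And>i. i \<ge> m \<Longrightarrow> \<exists>k. G ((1/2) ^ i) k \<omega> \<le> 0"
      unfolding eventually_sequentially by blast
    then have "\<omega> \<in> F m" unfolding F_def using \<omega> by blast
    then show "\<omega> \<in> (\<Union>m. F m)" by blast
  qed
  then have "interruption_prob M N Nc D (safe_policy S) \<le> prob (\<Union>m. F m)"
    unfolding interruption_prob_def by (rule finite_measure_mono) (use F in auto)
  then show ?thesis using le by simp
qed

lemma interruption_prob_threshold:
  assumes r0: "r0 > 0" "r0 + R0 * (exp (- r0) - 1) = 0"
    and r1: "r1 > 0" "r1 + (R0 + Rc) * (exp (- r1) - 1) = 0"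
    and D: "D > 0"
  shows "S = ereal s \<Longrightarrow> interruption_prob M N Nc D (safe_policy S) \<le> exp (- r1 * D) + exp (- r0 * s)"
    and "S = \<infinity> \<Longrightarrow> interruption_prob M N Nc D (safe_policy S) \<le> exp (- r1 * D)"
proof -
  assume S: "S = ereal s"
  have "(\<lambda>m. exp (- r0 * (s - (1/2) ^ m))) \<longlonglongrightarrow> exp (- r0 * (s - 0))"
    by (intro tendsto_intros tendsto_half_power)
  then have "(\<lambda>m. exp (- r0 * (s - (1/2) ^ m))) \<longlonglongrightarrow> exp (- r0 * s)" by simp
  then show "interruption_prob M N Nc D (safe_policy S) \<le> exp (- r1 * D) + exp (- r0 * s)"
    by (rule interruption_prob_le[OF r0 r1 D, rotated 2]) (use S r0(1) in auto)
next
  assume S: "S = \<infinity>"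
  have "interruption_prob M N Nc D (safe_policy S) \<le> exp (- r1 * D) + 0"
    by (rule interruption_prob_le[OF r0 r1 D, where q="\<lambda>_. 0"]) (use S in auto)
  then show "interruption_prob M N Nc D (safe_policy S) \<le> exp (- r1 * D)" by simp
qed

lemma \<tau>_nonneg: "0 \<le> \<tau> \<omega>"
  by (simp add: \<tau>_def hitting_time_nonneg)

lemma nn_integral_action:
  assumes "\<omega> \<in> space M"
  shows "(\<integral>\<^sup>+ t\<in>{0..}. ennreal (action N Nc D (safe_policy S) t \<omega>) \<partial>lborel) = e2ennreal (\<tau> \<omega>)"
proof -
  have "(\<integral>\<^sup>+ t\<in>{0..}. ennreal (action N Nc D (safe_policy S) t \<omega>) \<partial>lborel)
    = (\<integral>\<^sup>+ t. indicator {t. 0 \<le> t \<and> ereal t \<le> \<tau> \<omega>} t \<partial>lborel)"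
    using closed_loop_trajectory(1)[OF assms]
    by (intro nn_integral_cong) (auto simp: indicator_def)
  also have "\<dots> = e2ennreal (\<tau> \<omega>)"
  proof (cases "\<tau> \<omega>")
    case (real r)
    then have "0 \<le> r" using \<tau>_nonneg[of \<omega>] by simp
    moreover have "{t. 0 \<le> t \<and> ereal t \<le> \<tau> \<omega>} = {0..r}" using real by auto
    ultimately show ?thesis using real by simp
  next
    case PInf
    then have "{t. 0 \<le> t \<and> ereal t \<le> \<tau> \<omega>} = {0..}" by auto
    moreover have "emeasure lborel {0::real..} = \<infinity>"
    proof (rule ccontr)
      assume "emeasure lborel {0::real..} \<noteq> \<infinity>"
      then obtain r where r: "emeasure lborel {0::real..} = ennreal r" "r \<ge> 0"
        by (cases "emeasure lborel {0::real..}") auto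
      have "emeasure lborel {0..r + 1} \<le> emeasure lborel {0::real..}" by (intro emeasure_mono) auto
      then show False using r by simp
    qed
    ultimately show ?thesis using PInf by simp
  qed (use \<tau>_nonneg[of \<omega>] in auto)
  finally show ?thesis .
qed

lemma cost_eq:
  assumes "feasible_policy M N Nc D \<epsilon> (safe_policy S)"
  shows "cost M N Nc D \<epsilon> (safe_policy S) = (\<integral>\<^sup>+\<omega>. e2ennreal (\<tau> \<omega>) \<partial>M)"
  using assms nn_integral_action by (simp add: cost_def cong: nn_integral_cong)

lemma measurable_Y [measurable]: "0 \<le> t \<Longrightarrow> Y t \<in> borel_measurable M"
proof -
  assume t: "0 \<le> t"
  note [measurable] = measurable_N[OF t] measurable_Nc[OF t]
  show ?thesis unfolding Y_def[abs_def] by measurable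
qed

lemma measurable_grid_on:
  assumes "h > 0"
  shows "Measurable.pred M (grid_on h j)"
proof -
  have [measurable]: "Y (real i * h) \<in> borel_measurable M" for i
    using assms by (intro measurable_Y) simp
  show ?thesis unfolding grid_on_def[abs_def] by measurable
qed

lemma Y_increment:
  assumes "h > 0" "\<omega> \<in> space M"
  shows "Y (real (Suc i) * h) \<omega> - Y (real i * h) \<omega> = real (free_incr h i \<omega> + costly_incr h i \<omega>) - h"
  using real_increments[OF assms, of i] by (simp add: Y_def algebra_simps)

lemma nn_integral_sum_increments:
  assumes h: "h > 0"
  shows "(\<integral>\<^sup>+\<omega>. ennreal (real (free_incr h i \<omega> + costly_incr h i \<omega>)) \<partial>M) = ennreal ((R0 + Rc) * h)"
proof -
  note [measurable] = measurable_increments[OF h]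
  have "(\<integral>\<^sup>+\<omega>. ennreal (real (free_incr h i \<omega> + costly_incr h i \<omega>)) \<partial>M)
    = (\<integral>\<^sup>+\<omega>. ennreal (real (free_incr h i \<omega>)) + ennreal (real (costly_incr h i \<omega>)) \<partial>M)"
    by (intro nn_integral_cong) (simp only: of_nat_add ennreal_plus of_nat_0_le_iff)
  also have "\<dots> = (\<integral>\<^sup>+\<omega>. ennreal (real (free_incr h i \<omega>)) \<partial>M) + (\<integral>\<^sup>+\<omega>. ennreal (real (costly_incr h i \<omega>)) \<partial>M)"
    by (rule nn_integral_add) measurable
  also have "\<dots> = ennreal (R0 * h) + ennreal (Rc * h)"
    using h R0_pos Rc_pos nn_integral_increments[OF h, of "\<lambda>n. ennreal (real n)" i]
    by (simp only: nn_integral_poisson_mean mult_pos_pos)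
  finally show ?thesis
    using h R0_pos Rc_pos by (simp add: ennreal_plus[symmetric] distrib_right del: ennreal_plus)
qed

lemma grid_wald_step:
  fixes h :: real and i :: nat
  assumes h: "h > 0"
  defines "X \<equiv> \<lambda>\<omega>. if grid_on h i \<omega> then Y (real (Suc i) * h) \<omega> - Y (real i * h) \<omega> else 0"
    and "U \<equiv> \<lambda>\<omega>. if grid_on h i \<omega> then h else 0"
  shows "integrable M X" "integrable M U" "expectation X = (R0 + Rc - 1) * expectation U"
proof -
  note [measurable] = measurable_increments[OF h] measurable_grid_on[OF h]
  have Ri: "0 \<le> (R0 + Rc) * h" using h R0_pos Rc_pos by simp
  show U: "integrable M U" unfolding U_def
    by (rule integrable_const_bound[where B=h]) (use h in auto)
  define V where "V \<omega> = (if grid_on h i \<omega> then real (free_incr h i \<omega> + costly_incr h i \<omega>) else 0)" for \<omega>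
  have Vm[measurable]: "V \<in> borel_measurable M" unfolding V_def[abs_def] by measurable
  have "(\<integral>\<^sup>+\<omega>. ennreal (V \<omega>) \<partial>M)
    = (\<integral>\<^sup>+\<omega>. (if fst (snd (snd (state h i \<omega>))) then ennreal (real (fst (free_incr h i \<omega>, costly_incr h i \<omega>) + snd (free_incr h i \<omega>, costly_incr h i \<omega>))) else 0) \<partial>M)"
  proof (rule nn_integral_cong)
    fix \<omega> assume "\<omega> \<in> space M"
    then have "fst (snd (snd (state h i \<omega>))) = grid_on h i \<omega>" using state_eq[OF h, of \<omega> i] by auto
    then show "ennreal (V \<omega>) = (if fst (snd (snd (state h i \<omega>))) then ennreal (real (fst (free_incr h i \<omega>, costly_incr h i \<omega>) + snd (free_incr h i \<omega>, costly_incr h i \<omega>))) else 0)"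
      by (simp add: V_def)
  qed
  also have "\<dots> = (\<integral>\<^sup>+\<omega>. (\<integral>\<^sup>+\<omega>'. (if fst (snd (snd (state h i \<omega>))) then ennreal (real (fst (free_incr h i \<omega>', costly_incr h i \<omega>') + snd (free_incr h i \<omega>', costly_incr h i \<omega>'))) else 0) \<partial>M) \<partial>M)"
    unfolding state_def
    by (rule nn_integral_chain[OF indep_grid_increments[OF h],
        where F="\<lambda>s z. if fst (snd (snd s)) then ennreal (real (fst z + snd z)) else 0"])
  also have "\<dots> = (\<integral>\<^sup>+\<omega>. ennreal ((R0 + Rc) * U \<omega>) \<partial>M)"
  proof (rule nn_integral_cong)
    fix \<omega> assume "\<omega> \<in> space M"
    then have "fst (snd (snd (state h i \<omega>))) = grid_on h i \<omega>" using state_eq[OF h, of \<omega> i] by auto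
    then show "(\<integral>\<^sup>+\<omega>'. (if fst (snd (snd (state h i \<omega>))) then ennreal (real (fst (free_incr h i \<omega>', costly_incr h i \<omega>') + snd (free_incr h i \<omega>', costly_incr h i \<omega>'))) else 0) \<partial>M) = ennreal ((R0 + Rc) * U \<omega>)"
      using nn_integral_sum_increments[OF h, of i] by (simp add: U_def del: of_nat_add)
  qed
  also have "\<dots> = ennreal ((R0 + Rc) * expectation U)"
    using U R0_pos Rc_pos h by (subst nn_integral_eq_integral) (auto simp: U_def)
  finally have V: "(\<integral>\<^sup>+\<omega>. ennreal (V \<omega>) \<partial>M) = ennreal ((R0 + Rc) * expectation U)" .
  have V0: "0 \<le> V \<omega>" for \<omega> by (simp add: V_def)
  have intV: "integrable M V"
    using V V0 by (intro integrableI_nonneg) (auto simp: less_top[symmetric])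
  have "0 \<le> expectation U" using h by (intro integral_nonneg_AE) (auto simp: U_def)
  then have EV: "expectation V = (R0 + Rc) * expectation U"
    using R0_pos Rc_pos V V0 by (subst integral_eq_nn_integral) (auto simp: Vm)
  have X: "X \<omega> = V \<omega> - U \<omega>" if "\<omega> \<in> space M" for \<omega>
    using Y_increment[OF h that, of i] by (simp add: X_def V_def U_def del: of_nat_Suc of_nat_add)
  have "integrable M (\<lambda>\<omega>. V \<omega> - U \<omega>)" using intV U by simp
  then show "integrable M X" using X by (simp cong: Bochner_Integration.integrable_cong)
  have "expectation X = expectation (\<lambda>\<omega>. V \<omega> - U \<omega>)"
    using X by (intro Bochner_Integration.integral_cong) auto
  also have "\<dots> = (R0 + Rc - 1) * expectation U"
    using intV U EV by (simp add: algebra_simps)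
  finally show "expectation X = (R0 + Rc - 1) * expectation U" .
qed

definition capped_hit :: "nat \<Rightarrow> 'a \<Rightarrow> real" where
  "capped_hit K \<omega> = real_of_ereal (min (\<tau> \<omega>) (ereal (real K)))"

lemma capped_hit_bounds: "0 \<le> capped_hit K \<omega>" "capped_hit K \<omega> \<le> real K"
  unfolding capped_hit_def using \<tau>_nonneg[of \<omega>] by (cases "\<tau> \<omega>"; auto simp: min_def)+

lemma wald:
  shows "integrable M (capped_hit K)" and "integrable M (\<lambda>\<omega>. Y (capped_hit K \<omega>) \<omega>)"
    and "expectation (\<lambda>\<omega>. Y (capped_hit K \<omega>) \<omega>) = D + (R0 + Rc - 1) * expectation (capped_hit K)"
proof -
  define k where "k m = K * 2 ^ m" for m :: nat
  have k: "real (k m) * (1/2) ^ m = real K" for m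
    by (simp add: k_def power_one_over)
  define W where "W m \<omega> = (\<Sum>i<k m. if grid_on ((1/2) ^ m) i \<omega>
      then Y (real (Suc i) * (1/2) ^ m) \<omega> - Y (real i * (1/2) ^ m) \<omega> else 0)" for m \<omega>
  define T where "T m \<omega> = (\<Sum>i<k m. if grid_on ((1/2) ^ m) i \<omega> then (1/2) ^ m else (0::real))" for m \<omega>
  have h: "(1/2::real) ^ m > 0" for m by simp
  have intW: "integrable M (W m)" for m
    unfolding W_def by (intro Bochner_Integration.integrable_sum grid_wald_step(1)[OF h])
  have intT: "integrable M (T m)" for m
    unfolding T_def by (intro Bochner_Integration.integrable_sum grid_wald_step(2)[OF h])
  have E: "expectation (W m) = (R0 + Rc - 1) * expectation (T m)" for m
    unfolding W_def T_def using grid_wald_step[OF h]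
    by (simp add: Bochner_Integration.integral_sum sum_distrib_left del: of_nat_Suc)
  have limT: "(\<lambda>m. T m \<omega>) \<longlonglongrightarrow> capped_hit K \<omega>" and limW: "(\<lambda>m. W m \<omega>) \<longlonglongrightarrow> Y (capped_hit K \<omega>) \<omega> - D"
    if \<omega>: "\<omega> \<in> space M" for \<omega>
  proof -
    interpret P: buffer_path "\<lambda>t. N t \<omega>" "\<lambda>t. Nc t \<omega>" D S by (rule path[OF \<omega>])
    have "0 \<le> real K" by simp
    from P.tendsto_sum_on[OF this k, unfolded path_simps[OF \<omega>]]
    show "(\<lambda>m. T m \<omega>) \<longlonglongrightarrow> capped_hit K \<omega>" "(\<lambda>m. W m \<omega>) \<longlonglongrightarrow> Y (capped_hit K \<omega>) \<omega> - D"
      unfolding T_def W_def capped_hit_def by auto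
  qed
  define w where "w \<omega> = real K + (real (N (real K) \<omega>) + real (Nc (real K) \<omega>))" for \<omega>
  have boundW: "norm (W m \<omega>) \<le> w \<omega>" if \<omega>: "\<omega> \<in> space M" for m \<omega>
  proof -
    let ?h = "(1/2::real) ^ m"
    let ?f = "\<lambda>t. real (N t \<omega>) + real (Nc t \<omega>) + t"
    have "norm (W m \<omega>) \<le> (\<Sum>i<k m. norm (if grid_on ?h i \<omega>
      then Y (real (Suc i) * ?h) \<omega> - Y (real i * ?h) \<omega> else 0))" unfolding W_def by (rule norm_sum)
    also have "\<dots> \<le> (\<Sum>i<k m. ?f (real (Suc i) * ?h) - ?f (real i * ?h))"
    proof (rule sum_mono)
      fix i
      have "?f (real (Suc i) * ?h) - ?f (real i * ?h) = real (free_incr ?h i \<omega> + costly_incr ?h i \<omega>) + ?h"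
        using real_increments[OF h \<omega>, of m i] by (simp add: algebra_simps)
      then show "norm (if grid_on ?h i \<omega> then Y (real (Suc i) * ?h) \<omega> - Y (real i * ?h) \<omega> else 0)
          \<le> ?f (real (Suc i) * ?h) - ?f (real i * ?h)"
        unfolding Y_increment[OF h \<omega>] using h[of m] by (simp add: abs_le_iff del: of_nat_Suc)
    qed
    also have "\<dots> = ?f (real (k m) * ?h) - ?f (real 0 * ?h)" by (rule sum_lessThan_telescope)
    also have "\<dots> = w \<omega>" unfolding k w_def by (simp add: N_0[OF \<omega>] Nc_0[OF \<omega>])
    finally show ?thesis .
  qed
  have boundT: "norm (T m \<omega>) \<le> real K" for m \<omega>
  proof -
    have "norm (T m \<omega>) \<le> (\<Sum>i<k m. norm (if grid_on ((1/2) ^ m) i \<omega> then (1/2) ^ m else (0::real)))"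
      unfolding T_def by (rule norm_sum)
    also have "\<dots> \<le> (\<Sum>i<k m. (1/2) ^ m)" by (rule sum_mono) simp
    finally show ?thesis using k[of m] by simp
  qed
  have intw: "integrable M w"
  proof (cases "K = 0")
    case True
    have "integrable M (\<lambda>\<omega>. 0 :: real)" by simp
    then show ?thesis by (rule Bochner_Integration.integrable_cong[THEN iffD2, rotated 2])
      (use True N_0 Nc_0 in \<open>auto simp: w_def\<close>)
  next
    case False
    then have K: "real K > 0" by simp
    note [measurable] = measurable_N[of "real K"] measurable_Nc[of "real K"]
    have "(\<integral>\<^sup>+\<omega>. ennreal (real (N (real K) \<omega>) + real (Nc (real K) \<omega>)) \<partial>M)
      = (\<integral>\<^sup>+\<omega>. ennreal (real (free_incr (real K) 0 \<omega> + costly_incr (real K) 0 \<omega>)) \<partial>M)"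
      by (intro nn_integral_cong) (simp add: free_incr_def costly_incr_def N_0 Nc_0)
    also have "\<dots> < \<infinity>" unfolding nn_integral_sum_increments[OF K] by simp
    finally have "integrable M (\<lambda>\<omega>. real (N (real K) \<omega>) + real (Nc (real K) \<omega>))"
      by (intro integrableI_nonneg) auto
    then show ?thesis unfolding w_def by simp
  qed
  have mcapped[measurable]: "capped_hit K \<in> borel_measurable M"
    by (rule borel_measurable_LIMSEQ_real[OF limT]) (use intT in auto)
  have mW[measurable]: "(\<lambda>\<omega>. Y (capped_hit K \<omega>) \<omega> - D) \<in> borel_measurable M"
    by (rule borel_measurable_LIMSEQ_real[OF limW]) (use intW in auto)
  have T1: "integrable M (capped_hit K)" "(\<lambda>m. expectation (T m)) \<longlonglongrightarrow> expectation (capped_hit K)"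
    by (rule integrable_dominated_convergence[where w="\<lambda>_. real K" and s=T] integral_dominated_convergence[where w="\<lambda>_. real K"];
        use intT limT boundT in auto)+
  have W1: "integrable M (\<lambda>\<omega>. Y (capped_hit K \<omega>) \<omega> - D)"
    "(\<lambda>m. expectation (W m)) \<longlonglongrightarrow> expectation (\<lambda>\<omega>. Y (capped_hit K \<omega>) \<omega> - D)"
    by (rule integrable_dominated_convergence[where w=w and s=W] integral_dominated_convergence[where w=w];
        use intw intW limW boundW in auto)+
  show "integrable M (capped_hit K)" by (rule T1(1))
  have "integrable M (\<lambda>\<omega>. (Y (capped_hit K \<omega>) \<omega> - D) + D)"
    by (rule Bochner_Integration.integrable_add[OF W1(1)]) simp
  then show int: "integrable M (\<lambda>\<omega>. Y (capped_hit K \<omega>) \<omega>)" by simp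
  have "(\<lambda>m. expectation (W m)) \<longlonglongrightarrow> (R0 + Rc - 1) * expectation (capped_hit K)"
    unfolding E by (intro tendsto_intros T1(2))
  then have "expectation (\<lambda>\<omega>. Y (capped_hit K \<omega>) \<omega> - D) = (R0 + Rc - 1) * expectation (capped_hit K)"
    using W1(2) LIMSEQ_unique by blast
  then show "expectation (\<lambda>\<omega>. Y (capped_hit K \<omega>) \<omega>) = D + (R0 + Rc - 1) * expectation (capped_hit K)"
    using int by (simp add: prob_space)
qed

lemma prob_increment_ge2:
  assumes h: "h > 0"
  shows "prob {\<omega> \<in> space M. free_incr h i \<omega> + costly_incr h i \<omega> \<ge> 2} \<le> (R0 + Rc)\<^sup>2 * h\<^sup>2"
proof -
  note [measurable] = measurable_increments[OF h]
  have PA: "prob {\<omega> \<in> space M. free_incr h i \<omega> \<in> B} = measure (measure_pmf (poisson_pmf (R0 * h))) B"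
    and PB: "prob {\<omega> \<in> space M. costly_incr h i \<omega> \<in> B} = measure (measure_pmf (poisson_pmf (Rc * h))) B" for B
    unfolding distr_increments[OF h, of i, symmetric]
    by (simp_all add: measure_distr vimage_def Collect_conj_eq Int_commute)
  have l: "0 < R0 * h" "0 < Rc * h" using h R0_pos Rc_pos by auto
  have "prob {\<omega> \<in> space M. free_incr h i \<omega> + costly_incr h i \<omega> \<ge> 2}
    \<le> prob (({\<omega> \<in> space M. free_incr h i \<omega> \<in> {2..}} \<union> {\<omega> \<in> space M. costly_incr h i \<omega> \<in> {2..}})
        \<union> {\<omega> \<in> space M. free_incr h i \<omega> \<in> {1..} \<and> costly_incr h i \<omega> \<in> {1..}})"
    by (rule finite_measure_mono) auto
  also have "\<dots> \<le> prob {\<omega> \<in> space M. free_incr h i \<omega> \<in> {2..}} + prob {\<omega> \<in> space M. costly_incr h i \<omega> \<in> {2..}}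
      + prob {\<omega> \<in> space M. free_incr h i \<omega> \<in> {1..} \<and> costly_incr h i \<omega> \<in> {1..}}"
    by (intro order_trans[OF measure_Un_le] add_mono order_refl) auto
  also have "{\<omega> \<in> space M. free_incr h i \<omega> \<in> {1..} \<and> costly_incr h i \<omega> \<in> {1..}}
      = (\<lambda>\<omega>. (free_incr h i \<omega>, costly_incr h i \<omega>)) -` ({1..} \<times> {1..}) \<inter> space M" by auto
  also have "prob \<dots> = prob (free_incr h i -` {1..} \<inter> space M) * prob (costly_incr h i -` {1..} \<inter> space M)"
    by (rule indep_varD[OF indep_increment[OF h]]) auto
  also have "free_incr h i -` {1..} \<inter> space M = {\<omega> \<in> space M. free_incr h i \<omega> \<in> {1..}}" by auto
  also have "costly_incr h i -` {1..} \<inter> space M = {\<omega> \<in> space M. costly_incr h i \<omega> \<in> {1..}}" by auto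
  also have "prob {\<omega> \<in> space M. free_incr h i \<omega> \<in> {2..}} + prob {\<omega> \<in> space M. costly_incr h i \<omega> \<in> {2..}}
      + prob {\<omega> \<in> space M. free_incr h i \<omega> \<in> {1..}} * prob {\<omega> \<in> space M. costly_incr h i \<omega> \<in> {1..}}
    \<le> (R0 * h)\<^sup>2 + (Rc * h)\<^sup>2 + (R0 * h) * (Rc * h)"
    unfolding PA PB using l by (intro add_mono mult_mono poisson_ge1 poisson_ge2) auto
  also have "\<dots> \<le> (R0 * h)\<^sup>2 + (Rc * h)\<^sup>2 + 2 * ((R0 * h) * (Rc * h))"
    using mult_pos_pos[OF l] by linarith
  also have "\<dots> = (R0 + Rc)\<^sup>2 * h\<^sup>2" by (simp add: power2_eq_square algebra_simps)
  finally show ?thesis .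
qed

text \<open>Every arrival falls into a cell of the grid, so this forces all jumps of the buffer to have size one.\<close>

lemma AE_single_arrivals:
  "AE \<omega> in M. \<forall>K::nat. \<exists>m. \<forall>i<K * 2 ^ m. free_incr ((1/2) ^ m) i \<omega> + costly_incr ((1/2) ^ m) i \<omega> \<le> 1"
  unfolding AE_all_countable
proof
  fix K :: nat
  define B where "B m = (\<Union>i<K * 2 ^ m. {\<omega> \<in> space M. free_incr ((1/2) ^ m) i \<omega> + costly_incr ((1/2) ^ m) i \<omega> \<ge> 2})" for m
  have sets: "{\<omega> \<in> space M. free_incr ((1/2) ^ m) i \<omega> + costly_incr ((1/2) ^ m) i \<omega> \<ge> 2} \<in> sets M" for m i
  proof -
    have h: "(1/2::real) ^ m > 0" by simp
    have "(\<lambda>\<omega>. free_incr ((1/2) ^ m) i \<omega> + costly_incr ((1/2) ^ m) i \<omega>) \<in> measurable M (count_space UNIV)"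
      by (rule measurable_countable2[where F="(+)"]) (rule measurable_increments[OF h])+
    from measurable_sets[OF this, of "{2..}"] show ?thesis by (simp add: vimage_def Collect_conj_eq Int_commute)
  qed
  have B: "B m \<in> sets M" for m unfolding B_def using sets by auto
  have le: "prob (B m) \<le> real K * (R0 + Rc)\<^sup>2 * (1/2) ^ m" for m
  proof -
    let ?h = "(1/2::real) ^ m"
    have "prob (B m) \<le> (\<Sum>i<K * 2 ^ m. prob {\<omega> \<in> space M. free_incr ?h i \<omega> + costly_incr ?h i \<omega> \<ge> 2})"
      unfolding B_def by (intro measure_UNION_le sets) auto
    also have "\<dots> \<le> (\<Sum>i<K * 2 ^ m. (R0 + Rc)\<^sup>2 * ?h\<^sup>2)"
      by (intro sum_mono prob_increment_ge2) simp
    also have "\<dots> = real K * (R0 + Rc)\<^sup>2 * ?h"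
      by (simp add: power2_eq_square power_one_over)
    finally show ?thesis .
  qed
  have "prob (\<Inter>m. B m) \<le> 0"
  proof (rule LIMSEQ_le_const)
    show "(\<lambda>m. real K * (R0 + Rc)\<^sup>2 * (1/2) ^ m) \<longlonglongrightarrow> 0"
      using tendsto_mult_left[OF tendsto_half_power, of "real K * (R0 + Rc)\<^sup>2"] by simp
    have "prob (\<Inter>m. B m) \<le> prob (B m)" for m
      using B by (intro finite_measure_mono) auto
    then show "\<exists>N. \<forall>n\<ge>N. prob (\<Inter>m. B m) \<le> real K * (R0 + Rc)\<^sup>2 * (1/2) ^ n"
      using le order_trans by blast
  qed
  moreover have BI: "(\<Inter>m. B m) \<in> sets M" using B by auto
  ultimately have "(\<Inter>m. B m) \<in> null_sets M"
    by (intro null_setsI) (simp_all add: emeasure_eq_measure measure_le_0_iff)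
  moreover have "{\<omega> \<in> space M. \<not> (\<exists>m. \<forall>i<K * 2 ^ m. free_incr ((1/2) ^ m) i \<omega> + costly_incr ((1/2) ^ m) i \<omega> \<le> 1)} \<subseteq> (\<Inter>m. B m)"
  proof (intro subsetI INT_I)
    fix \<omega> m
    assume "\<omega> \<in> {\<omega> \<in> space M. \<not> (\<exists>m. \<forall>i<K * 2 ^ m. free_incr ((1/2) ^ m) i \<omega> + costly_incr ((1/2) ^ m) i \<omega> \<le> 1)}"
    then obtain i where \<omega>: "\<omega> \<in> space M" and i: "i < K * 2 ^ m"
      and "\<not> free_incr ((1/2) ^ m) i \<omega> + costly_incr ((1/2) ^ m) i \<omega> \<le> 1" by blast
    then have "2 \<le> free_incr ((1/2) ^ m) i \<omega> + costly_incr ((1/2) ^ m) i \<omega>" by linarith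
    then show "\<omega> \<in> B m" unfolding B_def using \<omega> i by blast
  qed
  ultimately show "AE \<omega> in M. \<exists>m. \<forall>i<K * 2 ^ m. free_incr ((1/2) ^ m) i \<omega> + costly_incr ((1/2) ^ m) i \<omega> \<le> 1"
    by (rule AE_I')
qed

lemma AE_overshoot:
  assumes S: "S = ereal s" and D: "D < s"
  shows "AE \<omega> in M. \<forall>T. \<tau> \<omega> = ereal T \<longrightarrow> Y T \<omega> < s + 1"
  using AE_single_arrivals AE_space
proof eventually_elim
  case (elim \<omega>)
  show ?case
  proof (intro allI impI)
    fix T assume T: "\<tau> \<omega> = ereal T"
    interpret P: buffer_path "\<lambda>t. N t \<omega>" "\<lambda>t. Nc t \<omega>" D S by (rule path[OF elim(2)])
    note ps = path_simps[OF elim(2)]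
    have T0: "0 \<le> T" using \<tau>_nonneg[of \<omega>] T by simp
    have "s \<le> Y T \<omega>" using P.y_at_hit[unfolded ps, OF T] S by simp
    then have "T \<noteq> 0" using D by (auto simp: Y_def N_0[OF elim(2)] Nc_0[OF elim(2)])
    then have T1: "0 < T" using T0 by simp
    define K where "K = nat \<lceil>T\<rceil>"
    have K: "T \<le> real K" unfolding K_def by linarith
    obtain m where m: "\<And>i. i < K * 2 ^ m \<Longrightarrow> free_incr ((1/2) ^ m) i \<omega> + costly_incr ((1/2) ^ m) i \<omega> \<le> 1"
      using elim(1) by blast
    let ?h = "(1/2::real) ^ m"
    have h: "?h > 0" by simp
    define j where "j = nat \<lceil>T / ?h\<rceil>"
    have "0 < j" using less_nat_ceiling_div_iff[OF h, of 0 T] T1 by (simp add: j_def)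
    then obtain i where i: "j = Suc i" using gr0_conv_Suc by blast
    have iT: "real i * ?h < T" using less_nat_ceiling_div_iff[OF h, of i T] i by (simp add: j_def)
    have Ti: "T \<le> real (Suc i) * ?h" using nat_ceiling_div_mult_bounds(1)[OF h T0] i by (simp only: j_def)
    have "real i * ?h < real (K * 2 ^ m) * ?h" using iT K by (simp add: power_one_over)
    then have "i < K * 2 ^ m" using h by (simp only: mult_less_cancel_right_pos of_nat_less_iff)
    then have "real (free_incr ?h i \<omega> + costly_incr ?h i \<omega>) \<le> 1" using m[of i] by linarith
    moreover have "real (N T \<omega>) + real (Nc T \<omega>) \<le> real (N (real (Suc i) * ?h) \<omega>) + real (Nc (real (Suc i) * ?h) \<omega>)"
      using N_le[OF elim(2) T0 Ti] Nc_le[OF elim(2) T0 Ti] by simp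
    moreover have "Y (real i * ?h) \<omega> < s"
      using P.y_below_before_hit[unfolded ps, of "real i * ?h"] iT T S by simp
    ultimately show "Y T \<omega> < s + 1"
      using real_increments[OF h elim(2), of i] iT by (simp add: Y_def del: of_nat_Suc)
  qed
qed

lemma e2ennreal_\<tau>: "e2ennreal (\<tau> \<omega>) = (SUP K. ennreal (capped_hit K \<omega>))"
proof (cases "\<tau> \<omega>")
  case (real r)
  then have r: "0 \<le> r" using \<tau>_nonneg[of \<omega>] by simp
  have capped_hit: "capped_hit K \<omega> = min r (real K)" for K unfolding capped_hit_def real by (simp add: min_def)
  have "(SUP K. ennreal (capped_hit K \<omega>)) = ennreal r"
  proof (rule antisym)
    show "(SUP K. ennreal (capped_hit K \<omega>)) \<le> ennreal r" unfolding capped_hit by (intro SUP_least ennreal_leI) simp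
    have "ennreal r \<le> ennreal (capped_hit (nat \<lceil>r\<rceil>) \<omega>)" unfolding capped_hit by (intro ennreal_leI) linarith
    also have "\<dots> \<le> (SUP K. ennreal (capped_hit K \<omega>))" by (rule SUP_upper) simp
    finally show "ennreal r \<le> (SUP K. ennreal (capped_hit K \<omega>))" .
  qed
  then show ?thesis using real by simp
next
  case PInf
  have "capped_hit K \<omega> = real K" for K by (simp add: capped_hit_def PInf)
  moreover have "(SUP K. ennreal (real K)) = \<top>"
    using ennreal_SUP_of_nat_eq_top by (simp only: ennreal_of_nat_eq_real_of_nat)
  moreover have "e2ennreal (\<tau> \<omega>) = \<top>" using PInf by simp
  ultimately show ?thesis by (simp only:)
qed (use \<tau>_nonneg[of \<omega>] in auto)

lemma nn_integral_\<tau>: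
  assumes S: "S = ereal s" and D: "D < s" and R: "R0 + Rc > 1"
  shows "\<exists>\<xi>. 0 \<le> \<xi> \<and> \<xi> < 1 \<and> s - D + \<xi> \<ge> 0 \<and>
    (\<integral>\<^sup>+\<omega>. e2ennreal (\<tau> \<omega>) \<partial>M) = ennreal ((s - D + \<xi>) / (R0 + Rc - 1))"
proof -
  define f where "f \<omega> = (SUP K. ennreal (capped_hit K \<omega>))" for \<omega>
  have mcapped[measurable]: "capped_hit K \<in> borel_measurable M" for K using wald(1)[of K] by simp
  have mYK[measurable]: "(\<lambda>\<omega>. Y (capped_hit K \<omega>) \<omega>) \<in> borel_measurable M" for K using wald(2)[of K] by simp
  have mf[measurable]: "f \<in> borel_measurable M" unfolding f_def[abs_def] by measurable
  have f\<tau>: "f \<omega> = e2ennreal (\<tau> \<omega>)" for \<omega> by (simp add: f_def e2ennreal_\<tau>)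
  have upper: "AE \<omega> in M. \<forall>K. Y (capped_hit K \<omega>) \<omega> < s + 1"
    using AE_overshoot[OF S D] AE_space
  proof eventually_elim
    case (elim \<omega>)
    interpret P: buffer_path "\<lambda>t. N t \<omega>" "\<lambda>t. Nc t \<omega>" D S by (rule path[OF elim(2)])
    note ps = path_simps[OF elim(2)]
    show ?case
    proof
      fix K
      show "Y (capped_hit K \<omega>) \<omega> < s + 1"
      proof (cases "\<tau> \<omega> \<le> ereal (real K)")
        case True
        then obtain T where "\<tau> \<omega> = ereal T" using \<tau>_nonneg[of \<omega>] by (cases "\<tau> \<omega>") auto
        then show ?thesis using elim(1) True by (simp add: capped_hit_def min_def)
      next
        case False
        then have "capped_hit K \<omega> = real K" by (simp add: capped_hit_def)
        moreover have "ereal (Y (real K) \<omega>) < S"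
          using False by (intro P.y_below_before_hit[unfolded ps]) auto
        ultimately show ?thesis using S by simp
      qed
    qed
  qed
  have Ecapped: "expectation (capped_hit K) \<le> (s + 1 - D) / (R0 + Rc - 1)" for K
  proof -
    have "AE \<omega> in M. Y (capped_hit K \<omega>) \<omega> \<le> s + 1" using upper by eventually_elim (simp add: less_imp_le)
    then have "expectation (\<lambda>\<omega>. Y (capped_hit K \<omega>) \<omega>) \<le> s + 1" by (intro integral_le_const wald(2))
    then show ?thesis using R unfolding wald(3) by (simp add: field_simps)
  qed
  have "(\<integral>\<^sup>+\<omega>. f \<omega> \<partial>M) = (SUP K. \<integral>\<^sup>+\<omega>. ennreal (capped_hit K \<omega>) \<partial>M)"
    unfolding f_def
  proof (rule nn_integral_monotone_convergence_SUP)
    show "incseq (\<lambda>K \<omega>. ennreal (capped_hit K \<omega>))"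
    proof (intro incseq_SucI le_funI ennreal_leI)
      fix K \<omega> show "capped_hit K \<omega> \<le> capped_hit (Suc K) \<omega>"
        unfolding capped_hit_def using \<tau>_nonneg[of \<omega>] by (cases "\<tau> \<omega>") (auto simp: min_def)
    qed
  qed measurable
  also have "\<dots> \<le> ennreal ((s + 1 - D) / (R0 + Rc - 1))"
    using Ecapped capped_hit_bounds(1) by (intro SUP_least) (simp add: nn_integral_eq_integral wald(1) ennreal_leI)
  finally have f_le: "(\<integral>\<^sup>+\<omega>. f \<omega> \<partial>M) \<le> ennreal ((s + 1 - D) / (R0 + Rc - 1))" .
  have f_fin: "(\<integral>\<^sup>+\<omega>. f \<omega> \<partial>M) < \<infinity>" by (rule le_less_trans[OF f_le]) simp
  then have AEf: "AE \<omega> in M. f \<omega> \<noteq> \<infinity>" by (intro nn_integral_noteq_infinite) auto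
  define g where "g \<omega> = enn2real (f \<omega>)" for \<omega>
  have mg[measurable]: "g \<in> borel_measurable M" unfolding g_def[abs_def] by measurable
  have AEg: "AE \<omega> in M. f \<omega> = ennreal (g \<omega>)" using AEf by eventually_elim (simp add: g_def less_top)
  have fg: "(\<integral>\<^sup>+\<omega>. f \<omega> \<partial>M) = (\<integral>\<^sup>+\<omega>. ennreal (g \<omega>) \<partial>M)" by (rule nn_integral_cong_AE[OF AEg])
  have intg: "integrable M g" using f_fin fg by (intro integrableI_nonneg) (auto simp: g_def)
  define Z where "Z \<omega> = lim (\<lambda>K. Y (capped_hit K \<omega>) \<omega>)" for \<omega>
  have mZ[measurable]: "Z \<in> borel_measurable M" unfolding Z_def[abs_def] by (rule borel_measurable_lim_metric) measurable
  have main: "AE \<omega> in M. (\<lambda>K. capped_hit K \<omega>) \<longlonglongrightarrow> g \<omega> \<and> (\<lambda>K. Y (capped_hit K \<omega>) \<omega>) \<longlonglongrightarrow> Z \<omega> \<and> s \<le> Z \<omega> \<and> Z \<omega> < s + 1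
      \<and> (\<forall>K. norm (capped_hit K \<omega>) \<le> g \<omega>) \<and> (\<forall>K. norm (Y (capped_hit K \<omega>) \<omega>) \<le> \<bar>s\<bar> + 1 + \<bar>D\<bar> + g \<omega>)"
    using AEf upper AE_overshoot[OF S D] AE_space
  proof eventually_elim
    case (elim \<omega>)
    interpret P: buffer_path "\<lambda>t. N t \<omega>" "\<lambda>t. Nc t \<omega>" D S by (rule path[OF elim(4)])
    note ps = path_simps[OF elim(4)]
    obtain T where T: "\<tau> \<omega> = ereal T" "0 \<le> T"
      using elim(1) \<tau>_nonneg[of \<omega>] unfolding f\<tau> by (cases "\<tau> \<omega>") auto
    have g: "g \<omega> = T" using T by (simp add: g_def f\<tau>)
    have capped_hit: "capped_hit K \<omega> = min T (real K)" for K unfolding capped_hit_def T by (simp add: min_def)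
    have ev: "\<forall>\<^sub>F K in sequentially. capped_hit K \<omega> = T"
      using eventually_ge_at_top[of "nat \<lceil>T\<rceil>"]
    proof eventually_elim
      case (elim K)
      then have "T \<le> real K" by linarith
      then show ?case by (simp add: capped_hit)
    qed
    have l1: "(\<lambda>K. capped_hit K \<omega>) \<longlonglongrightarrow> g \<omega>"
      unfolding g by (rule tendsto_eventually[OF ev])
    have l2: "(\<lambda>K. Y (capped_hit K \<omega>) \<omega>) \<longlonglongrightarrow> Y T \<omega>"
      by (rule tendsto_eventually) (use ev in eventually_elim, simp)
    then have Z: "Z \<omega> = Y T \<omega>" unfolding Z_def by (rule limI)
    have "s \<le> Y T \<omega>" using P.y_at_hit[unfolded ps, OF T(1)] S by simp
    moreover have "Y T \<omega> < s + 1" using elim(3) T by blast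
    moreover have "norm (capped_hit K \<omega>) \<le> T" for K using T(2) by (simp add: capped_hit)
    moreover have "norm (Y (capped_hit K \<omega>) \<omega>) \<le> \<bar>s\<bar> + 1 + \<bar>D\<bar> + T" for K
    proof -
      have "Y (capped_hit K \<omega>) \<omega> < s + 1" using elim(2) by blast
      moreover have "D - T \<le> Y (capped_hit K \<omega>) \<omega>" by (simp add: Y_def capped_hit)
      ultimately show ?thesis unfolding real_norm_def abs_le_iff
        using T(2) abs_ge_self[of s] abs_ge_minus_self[of D] by (intro conjI; linarith)
    qed
    ultimately show ?case using l1 l2 unfolding Z g by blast
  qed
  have dom: "integrable M (\<lambda>\<omega>. \<bar>s\<bar> + 1 + \<bar>D\<bar> + g \<omega>)" using intg by simp
  have conv: "AE \<omega> in M. (\<lambda>K. Y (capped_hit K \<omega>) \<omega>) \<longlonglongrightarrow> Z \<omega>" using main by eventually_elim blast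
  have bnd: "AE \<omega> in M. norm (Y (capped_hit K \<omega>) \<omega>) \<le> \<bar>s\<bar> + 1 + \<bar>D\<bar> + g \<omega>" for K using main by eventually_elim blast
  have intZ: "integrable M Z" by (rule integrable_dominated_convergence[OF mZ mYK dom conv bnd])
  have limZ: "(\<lambda>K. expectation (\<lambda>\<omega>. Y (capped_hit K \<omega>) \<omega>)) \<longlonglongrightarrow> expectation Z"
    by (rule integral_dominated_convergence[OF mZ mYK dom conv bnd])
  have convg: "AE \<omega> in M. (\<lambda>K. capped_hit K \<omega>) \<longlonglongrightarrow> g \<omega>" using main by eventually_elim blast
  have bndg: "AE \<omega> in M. norm (capped_hit K \<omega>) \<le> g \<omega>" for K using main by eventually_elim blast
  have "(\<lambda>K. expectation (capped_hit K)) \<longlonglongrightarrow> expectation g"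
    by (rule integral_dominated_convergence[OF mg mcapped intg convg bndg])
  then have "(\<lambda>K. expectation (\<lambda>\<omega>. Y (capped_hit K \<omega>) \<omega>)) \<longlonglongrightarrow> D + (R0 + Rc - 1) * expectation g"
    unfolding wald(3) by (intro tendsto_intros)
  then have EZ: "expectation Z = D + (R0 + Rc - 1) * expectation g"
    using limZ LIMSEQ_unique by blast
  have "s \<le> expectation Z" by (rule integral_ge_const[OF intZ]) (use main in eventually_elim, blast)
  moreover have "expectation Z < s + 1" by (rule expectation_less[OF intZ]) (use main in eventually_elim, blast)
  moreover have "(\<integral>\<^sup>+\<omega>. e2ennreal (\<tau> \<omega>) \<partial>M) = ennreal (expectation g)"
    using fg intg unfolding f\<tau> by (subst (asm) nn_integral_eq_integral) (auto simp: g_def)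
  moreover have "expectation g = (s - D + (expectation Z - s)) / (R0 + Rc - 1)"
    using EZ R by (simp add: field_simps)
  ultimately show ?thesis using D by (intro exI[of _ "expectation Z - s"]) auto
qed

lemma nn_integral_\<tau>_infinite:
  assumes "S = \<infinity>"
  shows "(\<integral>\<^sup>+\<omega>. e2ennreal (\<tau> \<omega>) \<partial>M) = \<infinity>"
proof -
  have "\<tau> \<omega> = \<infinity>" for \<omega>
    unfolding \<tau>_def hitting_time_def using assms by (simp add: top_ereal_def)
  then show ?thesis by (simp add: emeasure_space_1)
qed

end

theorem theorem4:
  fixes M :: "'a measure" and N Nc :: "real \<Rightarrow> 'a \<Rightarrow> nat"
    and R0 Rc R1 \<alpha>0 \<alpha>1 D \<epsilon> :: real and Sstar :: ereal
  assumes "prob_space M"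
    and "R0 > 1" and "Rc > 0" and "R1 = R0 + Rc"
    and "poisson_process M R0 N" and "poisson_process M Rc Nc"
    and "independent_processes M N Nc"
    and "\<alpha>0 = rbar R0" and "\<alpha>1 = rbar R1"
    and "(D, \<epsilon>) \<in> param_region \<alpha>0 \<alpha>1"
    and "Sstar = safe_threshold \<alpha>0 \<alpha>1 D \<epsilon>"
  shows "(\<forall>S\<ge>Sstar. feasible_policy M N Nc D \<epsilon> (safe_policy S)) \<and>
    (INF S\<in>{Sstar..}. cost M N Nc D \<epsilon> (safe_policy S)) = cost M N Nc D \<epsilon> (safe_policy Sstar) \<and>
    (\<exists>\<xi>::real. 0 \<le> \<xi> \<and> \<xi> < 1 \<and>
       enn2ereal (cost M N Nc D \<epsilon> (safe_policy Sstar)) =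
         ereal (1 / (R1 - 1)) * (Sstar - ereal D + ereal \<xi>))"
proof -
  have st: "streaming M N Nc R0 Rc"
    using assms by (simp add: streaming_def streaming_axioms_def)
  have r0: "\<alpha>0 > 0" "\<alpha>0 + R0 * (exp (- \<alpha>0) - 1) = 0"
    using rbar_root[of R0] assms by auto
  have r1: "\<alpha>1 > 0" "\<alpha>1 + (R0 + Rc) * (exp (- \<alpha>1) - 1) = 0"
    using rbar_root[of R1] assms by auto
  have \<epsilon>: "0 < \<epsilon>" "\<epsilon> < 1" and D1: "ln (1 / \<epsilon>) / \<alpha>1 \<le> D" and D0: "D \<le> ln (1 / \<epsilon>) / \<alpha>0"
    using assms by (auto simp: param_region_def)
  have "0 < ln (1 / \<epsilon>) / \<alpha>1" using \<epsilon> r1 by simp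
  then have D: "D > 0" using D1 by simp
  have "- (\<alpha>1 * D) \<le> ln \<epsilon>" using D1 r1 \<epsilon> by (simp add: field_simps ln_div)
  then have e\<epsilon>: "exp (- \<alpha>1 * D) \<le> \<epsilon>" using \<epsilon> by (simp add: ln_ge_iff)
  have Sstar: "(\<exists>s. Sstar = ereal s \<and> D < s \<and> exp (- \<alpha>1 * D) + exp (- \<alpha>0 * s) = \<epsilon>) \<or> Sstar = \<infinity>"
  proof (cases "\<epsilon> = exp (- \<alpha>1 * D)")
    case False
    define \<delta> where "\<delta> = \<epsilon> - exp (- \<alpha>1 * D)"
    define s where "s = 1 / \<alpha>0 * ln (1 / \<delta>)"
    have \<delta>: "0 < \<delta>" "\<delta> < \<epsilon>" using False e\<epsilon> by (auto simp: \<delta>_def)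
    have "- \<alpha>0 * s = ln \<delta>" using r0 \<delta> by (simp add: s_def ln_div)
    then have "exp (- \<alpha>0 * s) = \<delta>" using \<delta> by simp
    moreover have "Sstar = ereal s" using assms False by (simp add: safe_threshold_def s_def \<delta>_def)
    moreover have "ln (1 / \<epsilon>) < ln (1 / \<delta>)" using \<delta> \<epsilon> by (simp add: ln_div)
    then have "ln (1 / \<epsilon>) / \<alpha>0 < s" using r0 by (simp add: s_def divide_strict_right_mono)
    then have "D < s" using D0 by simp
    ultimately show ?thesis by (auto simp: \<delta>_def)
  qed (use assms in \<open>simp add: safe_threshold_def\<close>)
  have feas: "feasible_policy M N Nc D \<epsilon> (safe_policy S)" if S: "S \<ge> Sstar" for S
    unfolding feasible_policy_def
  proof
    interpret streaming M N Nc R0 Rc D S by (rule st)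
    consider s where "S = ereal s" | "S = \<infinity>" using S Sstar by (cases S) auto
    then show "interruption_prob M N Nc D (safe_policy S) \<le> \<epsilon>"
    proof cases
      case (1 s)
      then obtain s' where s': "Sstar = ereal s'" "exp (- \<alpha>1 * D) + exp (- \<alpha>0 * s') = \<epsilon>" "s' \<le> s"
        using S Sstar by auto
      have "exp (- \<alpha>0 * s) \<le> exp (- \<alpha>0 * s')" using s' r0 by simp
      then show ?thesis using interruption_prob_threshold(1)[OF r0 r1 D 1] s'(2) by linarith
    next
      case 2
      then show ?thesis using interruption_prob_threshold(2)[OF r0 r1 D 2] e\<epsilon> by simp
    qed
  qed (rule online_safe_policy)
  have cost: "cost M N Nc D \<epsilon> (safe_policy S) = (\<integral>\<^sup>+\<omega>. e2ennreal (streaming.\<tau> N Nc D S \<omega>) \<partial>M)"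
    if "S \<ge> Sstar" for S
    by (rule streaming.cost_eq[OF st feas[OF that]])
  have mono: "cost M N Nc D \<epsilon> (safe_policy Sstar) \<le> cost M N Nc D \<epsilon> (safe_policy S)" if "S \<ge> Sstar" for S
    unfolding cost[OF that] cost[OF order_refl] streaming.\<tau>_def[OF st] hitting_time_def
    by (intro nn_integral_mono e2ennreal_mono INF_superset_mono) (use that order_trans in auto)
  have "(INF S\<in>{Sstar..}. cost M N Nc D \<epsilon> (safe_policy S)) = cost M N Nc D \<epsilon> (safe_policy Sstar)"
    by (rule antisym) (use mono in \<open>auto intro: INF_lower INF_greatest\<close>)
  moreover have "\<exists>\<xi>::real. 0 \<le> \<xi> \<and> \<xi> < 1 \<and>
       enn2ereal (cost M N Nc D \<epsilon> (safe_policy Sstar)) =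
         ereal (1 / (R1 - 1)) * (Sstar - ereal D + ereal \<xi>)"
    using Sstar
  proof
    assume "\<exists>s. Sstar = ereal s \<and> D < s \<and> exp (- \<alpha>1 * D) + exp (- \<alpha>0 * s) = \<epsilon>"
    then obtain s where s: "Sstar = ereal s" "D < s" by blast
    have "R0 + Rc > 1" using assms by simp
    from streaming.nn_integral_\<tau>[OF st s this] obtain \<xi> where \<xi>: "0 \<le> \<xi>" "\<xi> < 1" "s - D + \<xi> \<ge> 0"
      "(\<integral>\<^sup>+\<omega>. e2ennreal (streaming.\<tau> N Nc D Sstar \<omega>) \<partial>M) = ennreal ((s - D + \<xi>) / (R0 + Rc - 1))" by blast
    have "enn2ereal (cost M N Nc D \<epsilon> (safe_policy Sstar)) = ereal ((s - D + \<xi>) / (R0 + Rc - 1))"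
      unfolding cost[OF order_refl] \<xi>(4) using \<xi>(3) assms by (simp add: enn2ereal_ennreal)
    also have "\<dots> = ereal (1 / (R1 - 1)) * (Sstar - ereal D + ereal \<xi>)"
      using s assms by simp
    finally show ?thesis using \<xi> by blast
  next
    assume S: "Sstar = \<infinity>"
    have "enn2ereal (cost M N Nc D \<epsilon> (safe_policy Sstar)) = \<infinity>"
      unfolding cost[OF order_refl] streaming.nn_integral_\<tau>_infinite[OF st S] by simp
    also have "\<dots> = ereal (1 / (R1 - 1)) * (Sstar - ereal D + ereal 0)"
      using S assms by simp
    finally show ?thesis by (intro exI[of _ 0]) simp
  qed
  ultimately show ?thesis using feas by blast
qed

end
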